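(* There exists a sequence of total Boolean functions $f_j:\{0,1\}^{N_j}\to\{0,1\}$ with $\mathrm{UC}(f_j)\to\infty$ such that $D(f_j)\geq \mathrm{UC}(f_j)^{2-o(1)}$, i.e. $D(f_j)\geq \mathrm{UC}(f_j)^{2-\epsilon_j}$ for some sequence $\epsilon_j\to0$.
   Context: For $f:\{0,1\}^n\to\{0,1\}$, $D(f)$ is the deterministic query complexity: the minimum, over deterministic decision trees computing $f$ on all inputs, of the worst-case number of input bits queried. A certificate for an input $x$ is a partial assignment (a set of indices together with values) consistent with $x$ such that every input consistent with it has the same $f$-value as $x$. The unambiguous $b$-certificate complexity $\mathrm{UC}_b(f)$ ($b\in\{0,1\}$) is the minimum $w$ such that there is a set of partial assignments, each fixing at most $w$ variables, each being a certificate for value $b$, such that every input $x$ with $f(x)=b$ is consistent with exactly one of them (equivalently, for $b=1$: $f$ is a width-$w$ DNF in which at most one term evaluates to 1 on any input). $\mathrm{UC}(f)=\max\{\mathrm{UC}_0(f),\mathrm{UC}_1(f)\}$ (subcube partition complexity). *)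

theory Defs
  imports Complex_Main "HOL-Library.FuncSet"
begin

text \<open>
  Boolean functions are taken over an arbitrary finite index set \<open>I\<close> of variables; the usual
  cube is \<open>I = {..<n}\<close>. Only the values of \<open>f\<close> on \<open>cube I\<close> matter below.
\<close>

definition cube :: "'i set \<Rightarrow> ('i \<Rightarrow> bool) set" where
  "cube I = I \<rightarrow>\<^sub>E UNIV"

datatype 'i dtree = Leaf bool | Query 'i "'i dtree" "'i dtree"

fun dt_vars :: "'i dtree \<Rightarrow> 'i set" where
  "dt_vars (Leaf b) = {}"
| "dt_vars (Query i l r) = insert i (dt_vars l \<union> dt_vars r)"

fun dt_eval :: "'i dtree \<Rightarrow> ('i \<Rightarrow> bool) \<Rightarrow> bool" where
  "dt_eval (Leaf b) x = b"
| "dt_eval (Query i l r) x = (if x i then dt_eval r x else dt_eval l x)"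

fun dt_cost :: "'i dtree \<Rightarrow> ('i \<Rightarrow> bool) \<Rightarrow> nat" where
  "dt_cost (Leaf b) x = 0"
| "dt_cost (Query i l r) x = Suc (if x i then dt_cost r x else dt_cost l x)"

definition dt_computes :: "'i set \<Rightarrow> 'i dtree \<Rightarrow> (('i \<Rightarrow> bool) \<Rightarrow> bool) \<Rightarrow> bool" where
  "dt_computes I t f \<longleftrightarrow> dt_vars t \<subseteq> I \<and> (\<forall>x\<in>cube I. dt_eval t x = f x)"

definition D :: "'i set \<Rightarrow> (('i \<Rightarrow> bool) \<Rightarrow> bool) \<Rightarrow> nat" where
  "D I f = (LEAST d. \<exists>t. dt_computes I t f \<and> (\<forall>x\<in>cube I. dt_cost t x \<le> d))"

definition consistent :: "('i \<rightharpoonup> bool) \<Rightarrow> ('i \<Rightarrow> bool) \<Rightarrow> bool" where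
  "consistent p x \<longleftrightarrow> (\<forall>i\<in>dom p. p i = Some (x i))"

definition certificate ::
    "'i set \<Rightarrow> (('i \<Rightarrow> bool) \<Rightarrow> bool) \<Rightarrow> ('i \<Rightarrow> bool) \<Rightarrow> ('i \<rightharpoonup> bool) \<Rightarrow> bool" where
  "certificate I f x p \<longleftrightarrow>
     dom p \<subseteq> I \<and> consistent p x \<and> (\<forall>y\<in>cube I. consistent p y \<longrightarrow> f y = f x)"

definition unambiguous_family ::
    "'i set \<Rightarrow> (('i \<Rightarrow> bool) \<Rightarrow> bool) \<Rightarrow> bool \<Rightarrow> ('i \<rightharpoonup> bool) set \<Rightarrow> bool" where
  "unambiguous_family I f b P \<longleftrightarrow>
     (\<forall>p\<in>P. \<exists>x\<in>cube I. f x = b \<and> certificate I f x p) \<and>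
     (\<forall>x\<in>cube I. f x = b \<longrightarrow> (\<exists>!p. p \<in> P \<and> consistent p x))"

definition UCb :: "bool \<Rightarrow> 'i set \<Rightarrow> (('i \<Rightarrow> bool) \<Rightarrow> bool) \<Rightarrow> nat" where
  "UCb b I f =
     (LEAST w. \<exists>P. unambiguous_family I f b P \<and> (\<forall>p\<in>P. card (dom p) \<le> w))"

definition UC :: "'i set \<Rightarrow> (('i \<Rightarrow> bool) \<Rightarrow> bool) \<Rightarrow> nat" where
  "UC I f = max (UCb False I f) (UCb True I f)"

text \<open>For finite \<open>I\<close> both minima range over nonempty sets.\<close>

lemma dt_computes_exists:
  assumes "finite I"
  shows "\<exists>t. dt_computes I t f \<and> (\<forall>x. dt_cost t x \<le> card I)"
proof -
  have "\<exists>t. dt_vars t \<subseteq> I \<and> (\<forall>x. dt_cost t x \<le> card J) \<and>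
            (\<forall>x\<in>cube I. (\<forall>i\<in>I - J. x i = y i) \<longrightarrow> dt_eval t x = f x)"
    if "finite J" "J \<subseteq> I" "y \<in> cube I" for J y
    using that
  proof (induction J arbitrary: y rule: finite_induct)
    case empty
    have "x = y" if "x \<in> cube I" "\<forall>i\<in>I. x i = y i" for x
      using that empty.prems by (auto simp: cube_def intro: PiE_ext)
    then show ?case by (intro exI[of _ "Leaf (f y)"]) auto
  next
    case (insert j J)
    have j: "j \<in> I" using insert.prems by auto
    have "y(j := c) \<in> cube I" for c
      using insert.prems(2) j by (auto simp: cube_def PiE_iff extensional_def)
    then have "\<forall>c. \<exists>t. dt_vars t \<subseteq> I \<and> (\<forall>x. dt_cost t x \<le> card J) \<and>
            (\<forall>x\<in>cube I. (\<forall>i\<in>I - J. x i = (y(j := c)) i) \<longrightarrow> dt_eval t x = f x)"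
      using insert.IH insert.prems by blast
    then obtain t where t: "\<And>c. dt_vars (t c) \<subseteq> I" "\<And>c x. dt_cost (t c) x \<le> card J"
      "\<And>c x. x \<in> cube I \<Longrightarrow> \<forall>i\<in>I - J. x i = (y(j := c)) i \<Longrightarrow> dt_eval (t c) x = f x"
      by metis
    have ev: "dt_eval (t (x j)) x = f x"
      if "x \<in> cube I" "\<forall>i\<in>I - insert j J. x i = y i" for x
      using that by (intro t(3)) auto
    show ?case
    proof (intro exI[of _ "Query j (t False) (t True)"] conjI allI ballI impI)
      show "dt_eval (Query j (t False) (t True)) x = f x"
        if "x \<in> cube I" "\<forall>i\<in>I - insert j J. x i = y i" for x
        using ev[OF that] by (cases "x j") simp_all
    qed (use t(1,2) j insert.hyps in auto)
  qed
  from this[of I "\<lambda>i\<in>I. False"] assms show ?thesis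
    by (auto simp: dt_computes_def cube_def)
qed

lemma unambiguous_family_exists:
  "\<exists>P. unambiguous_family I f b P \<and> (\<forall>p\<in>P. dom p = I)"
proof -
  define q where "q x = (\<lambda>i. if i \<in> I then Some (x i) else None)" for x :: "'a \<Rightarrow> bool"
  have dom: "dom (q x) = I" for x by (auto simp: q_def dom_def)
  have cons: "consistent (q x) y \<longleftrightarrow> y = x" if "x \<in> cube I" "y \<in> cube I" for x y
    using that unfolding consistent_def dom
    by (auto simp: q_def cube_def intro: PiE_ext)
  have "unambiguous_family I f b (q ` {x \<in> cube I. f x = b})"
    unfolding unambiguous_family_def certificate_def
    using cons dom by fastforce
  then show ?thesis using dom by blast
qed

end

theory Submission
  imports Defs "HOL-Library.Countable" "HOL-Real_Asymp.Real_Asymp"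
begin

text \<open>
  Let \<open>n = 2 ^ m\<close>. One round turns \<open>f\<close> into \<open>AND\<^sub>n \<circ> (OR\<^sub>n \<circ> f)\<^sub>C\<^sub>S\<close>, where
  the cheat sheet \<open>g\<^sub>C\<^sub>S\<close> preserves the query complexity of \<open>g\<close> and, up to a factor of order
  \<open>c = log D(g)\<close>, brings the unambiguous 1-certificates of \<open>g\<close> down to the length of its
  ordinary certificates. Starting from \<open>AND\<^sub>n\<close>, after \<open>k\<close> rounds \<open>D \<ge> n ^ (2 k + 1)\<close>,
  while up to factors polynomial in \<open>m\<close> the 0-certificates have length \<open>n ^ k\<close> and the
  1-certificates and both unambiguous certificates have length \<open>n ^ (k + 1)\<close>. For \<open>m\<close>
  large in terms of \<open>k\<close> this gives the exponent \<open>2 - 2 / (k + 1)\<close>. The size of a cell is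
  controlled by counting the sets of positions that certificates may use: \<open>2 ^ w\<close> such
  sets can be named by \<open>w\<close> bits, whatever the number of variables.
\<close>

section \<open>Adversaries and certificates\<close>

text \<open>
  Functions take total inputs over the whole index type; every one used below depends on
  finitely many variables only, as \<open>query_map\<close> implies.
\<close>

definition certifies :: "(('i \<Rightarrow> bool) \<Rightarrow> bool) \<Rightarrow> 'i set \<Rightarrow> ('i \<Rightarrow> bool) \<Rightarrow> bool" where
  "certifies f S x \<longleftrightarrow> (\<forall>y. (\<forall>i\<in>S. y i = x i) \<longrightarrow> f y = f x)"

text \<open>A game: \<open>p\<close> holds the answers given so far, and the adversary can keep both
  values of \<open>f\<close> possible before each of the next \<open>d\<close> queries to new
  variables. No decision tree occurs in it, so strategies can be combined query by query.\<close>

primrec adversary :: "(('i \<Rightarrow> bool) \<Rightarrow> bool) \<Rightarrow> nat \<Rightarrow> ('i \<rightharpoonup> bool) \<Rightarrow> bool" where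
  "adversary f 0 p \<longleftrightarrow> True"
| "adversary f (Suc d) p \<longleftrightarrow>
     (\<forall>b. \<exists>x. consistent p x \<and> f x = b) \<and>
     (\<forall>i. p i = None \<longrightarrow> (\<exists>b. adversary f d (p(i \<mapsto> b))))"

text \<open>The single parameter \<open>w\<close> bounds both the length of a certificate and the
  number of bits needed to name its set of positions.\<close>

definition cert_sets ::
    "(('i \<Rightarrow> bool) \<Rightarrow> bool) \<Rightarrow> bool \<Rightarrow> nat \<Rightarrow> 'i set set \<Rightarrow> bool" where
  "cert_sets f b w \<S> \<longleftrightarrow>
     finite \<S> \<and> card \<S> \<le> 2 ^ w \<and> (\<forall>S\<in>\<S>. finite S \<and> card S \<le> w) \<and>
     (\<forall>x. f x = b \<longrightarrow> (\<exists>S\<in>\<S>. certifies f S x))"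

definition certifiable :: "(('i \<Rightarrow> bool) \<Rightarrow> bool) \<Rightarrow> bool \<Rightarrow> nat \<Rightarrow> bool" where
  "certifiable f b w \<longleftrightarrow> (\<exists>\<S>. cert_sets f b w \<S>)"

text \<open>
  An unambiguous family is presented by the map \<open>U\<close> that sends an input to the domain of
  the unique certificate consistent with it.
\<close>

definition query_map ::
    "(('i \<Rightarrow> bool) \<Rightarrow> bool) \<Rightarrow> (bool \<Rightarrow> nat) \<Rightarrow> 'i set \<Rightarrow> (('i \<Rightarrow> bool) \<Rightarrow> 'i set) \<Rightarrow> bool" where
  "query_map f u J U \<longleftrightarrow>
     finite J \<and> (\<forall>x. U x \<subseteq> J \<and> card (U x) \<le> u (f x) \<and>
       (\<forall>y. (\<forall>i\<in>U x. y i = x i) \<longrightarrow> f y = f x \<and> U y = U x))"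

definition unamb :: "(('i \<Rightarrow> bool) \<Rightarrow> bool) \<Rightarrow> (bool \<Rightarrow> nat) \<Rightarrow> bool" where
  "unamb f u \<longleftrightarrow> (\<exists>J U. query_map f u J U)"

text \<open>This lower bound on 1-certificates is what makes UC grow along the sequence. Finiteness
  is demanded because \<open>card\<close> is 0 on infinite sets.\<close>

definition min_cert :: "(('i \<Rightarrow> bool) \<Rightarrow> bool) \<Rightarrow> nat \<Rightarrow> bool" where
  "min_cert f s \<longleftrightarrow> (\<forall>x S. f x \<longrightarrow> finite S \<longrightarrow> certifies f S x \<longrightarrow> s \<le> card S)"

lemma certifiesD: "certifies f S x \<Longrightarrow> \<forall>i\<in>S. y i = x i \<Longrightarrow> f y = f x"
  unfolding certifies_def by blast

lemma certifies_cong: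
  assumes "\<forall>i\<in>S. y i = x i" and "f y = f x"
  shows "certifies f S y = certifies f S x"
  using assms unfolding certifies_def by simp

lemma consistent_iff: "consistent p x \<longleftrightarrow> (\<forall>i b. p i = Some b \<longrightarrow> x i = b)"
  unfolding consistent_def by (auto simp: dom_def)

lemma consistent_default: "consistent p (\<lambda>i. p i = Some True)"
  unfolding consistent_iff by auto

lemma consistent_update: "consistent (p(i \<mapsto> b)) x \<Longrightarrow> p i = None \<Longrightarrow> consistent p x \<and> x i = b"
  unfolding consistent_iff by (metis fun_upd_apply option.distinct(1))

lemma adversary_undecided:
  assumes "adversary f d p" and "d > 0"
  shows "\<exists>x. consistent p x \<and> f x = b"
  using assms(1,2) unfolding gr0_conv_Suc by (elim exE) (simp only: adversary.simps(2))

lemma adversary_answer: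
  assumes "adversary f (Suc d) p" and "p i = None"
  shows "\<exists>b. adversary f d (p(i \<mapsto> b))"
  using assms unfolding adversary.simps(2) by blast

lemma adversary_Suc: "adversary f (Suc d) p \<Longrightarrow> adversary f d p"
proof (induction d arbitrary: p)
  case (Suc d)
  then show ?case
    unfolding adversary.simps(2)[of f "Suc d"] adversary.simps(2)[of f d] by blast
qed simp

lemma adversary_antimono: "adversary f d p \<Longrightarrow> e \<le> d \<Longrightarrow> adversary f e p"
proof (induction d)
  case (Suc d)
  then show ?case using adversary_Suc by (metis le_Suc_eq)
qed simp

text \<open>Induction on the tree: at a new variable the branch follows the adversary's answer, at a
  fixed one the fixed value. A leaf reached with positive budget would be wrong on an input that is
  still possible.\<close>

lemma adversary_cost:
  assumes "adversary f d p" and "\<And>x. consistent p x \<Longrightarrow> dt_eval t x = f x"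
  shows "\<exists>x. consistent p x \<and> d \<le> dt_cost t x"
  using assms
proof (induction t arbitrary: d p)
  case (Leaf b)
  show ?case
  proof (cases d)
    case 0
    then show ?thesis using consistent_default by blast
  next
    case (Suc e)
    with Leaf.prems(1) obtain x where "consistent p x" "f x = (\<not> b)" by auto
    with Leaf.prems(2) show ?thesis by auto
  qed
next
  case (Query i l r)
  have child: "\<exists>x. consistent q x \<and> d \<le> Suc (dt_cost (if b then r else l) x)"
    if adv: "adversary f (d - 1) q" and q: "\<And>x. consistent q x \<Longrightarrow> consistent p x \<and> x i = b" for q b
  proof -
    have "dt_eval (if b then r else l) x = f x" if "consistent q x" for x
      using Query.prems(2)[of x] q[OF that]
      by (cases b) auto
    then have "\<exists>x. consistent q x \<and> d - 1 \<le> dt_cost (if b then r else l) x"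
      using Query.IH(1)[OF adv] Query.IH(2)[OF adv] by (cases b) simp_all
    then obtain x where "consistent q x" "d - 1 \<le> dt_cost (if b then r else l) x" by blast
    then show ?thesis by (intro exI[of _ x]) simp
  qed
  have "\<exists>q b. adversary f (d - 1) q \<and> (\<forall>x. consistent q x \<longrightarrow> consistent p x \<and> x i = b)"
  proof (cases "p i")
    case None
    show ?thesis
    proof (cases d)
      case 0
      then show ?thesis
        using consistent_update[of p i, OF _ None] by (intro exI[of _ "p(i \<mapsto> True)"] exI[of _ True]) auto
    next
      case (Suc e)
      then obtain b where "adversary f e (p(i \<mapsto> b))" using Query.prems(1) None by auto
      then show ?thesis
        using Suc consistent_update[of p i, OF _ None]
        by (intro exI[of _ "p(i \<mapsto> b)"] exI[of _ b]) auto
    qed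
  next
    \<comment> \<open>A repeated query reveals nothing, so \<open>p\<close> stays and the budget may
      drop by one.\<close>
    case (Some b)
    then have "\<forall>x. consistent p x \<longrightarrow> x i = b" unfolding consistent_iff by simp
    then show ?thesis
      using adversary_antimono[OF Query.prems(1), of "d - 1"] by (intro exI[of _ p] exI[of _ b]) simp
  qed
  then obtain q b where q: "adversary f (d - 1) q"
    "\<And>x. consistent q x \<Longrightarrow> consistent p x \<and> x i = b" by blast
  from child[OF this] obtain x where "consistent q x" "d \<le> Suc (dt_cost (if b then r else l) x)"
    by blast
  then show ?case using q(2)[of x] by (intro exI[of _ x]) auto
qed

lemma adversary_not: "adversary (\<lambda>x. \<not> f x) d p = adversary f d p"
proof (induction d arbitrary: p)
  case (Suc d)
  have "(\<forall>b. \<exists>x. consistent p x \<and> (\<not> f x) = b) = (\<forall>b. \<exists>x. consistent p x \<and> f x = b)"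
    unfolding all_bool_eq by auto
  then show ?case by (simp only: adversary.simps(2) Suc)
qed simp

lemma certifies_not: "certifies (\<lambda>x. \<not> f x) = certifies f"
  unfolding certifies_def by (intro ext) auto

lemma cert_setsD:
  assumes "cert_sets f b w \<S>"
  shows "finite \<S>" and "card \<S> \<le> 2 ^ w"
    and "S \<in> \<S> \<Longrightarrow> finite S" and "S \<in> \<S> \<Longrightarrow> card S \<le> w"
    and "f x = b \<Longrightarrow> \<exists>S\<in>\<S>. certifies f S x"
  using assms unfolding cert_sets_def by simp_all

lemma query_mapD:
  assumes "query_map f u J U"
  shows "finite J" and "U x \<subseteq> J" and "finite (U x)" and "card (U x) \<le> u (f x)"
    and "\<forall>i\<in>U x. y i = x i \<Longrightarrow> f y = f x \<and> U y = U x"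
proof -
  note J = assms[unfolded query_map_def, THEN conjunct1]
  note q = assms[unfolded query_map_def, THEN conjunct2, THEN spec[of _ x]]
  show "finite J" by (rule J)
  show sub: "U x \<subseteq> J" by (rule q[THEN conjunct1])
  show "finite (U x)" using sub J by (rule finite_subset)
  show "card (U x) \<le> u (f x)" by (rule q[THEN conjunct2, THEN conjunct1])
  show "f y = f x \<and> U y = U x" if "\<forall>i\<in>U x. y i = x i"
    using q[THEN conjunct2, THEN conjunct2, THEN spec, THEN mp, OF that] .
qed

lemma certifiable_not: "certifiable (\<lambda>x. \<not> f x) b w = certifiable f (\<not> b) w"
  unfolding certifiable_def cert_sets_def certifies_not by (cases b) simp_all

lemma unamb_not: "unamb f u \<Longrightarrow> unamb (\<lambda>x. \<not> f x) (\<lambda>b. u (\<not> b))"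
  unfolding unamb_def query_map_def by simp

lemma certifiable_mono:
  assumes "certifiable f b w" and "w \<le> w'"
  shows "certifiable f b w'"
proof -
  obtain \<S> where "cert_sets f b w \<S>" using assms(1) unfolding certifiable_def by blast
  note S = cert_setsD[OF this]
  have "(2::nat) ^ w \<le> 2 ^ w'" using assms(2) by simp
  then have "card \<S> \<le> 2 ^ w'" using S(2) by linarith
  moreover have "\<forall>S\<in>\<S>. finite S \<and> card S \<le> w'" using S(3,4) assms(2) le_trans by blast
  ultimately have "cert_sets f b w' \<S>" using S(1,5) unfolding cert_sets_def by simp
  then show ?thesis unfolding certifiable_def by blast
qed

lemma unamb_mono:
  assumes "unamb f u" and "\<And>b. u b \<le> v b"
  shows "unamb f v"
proof -
  obtain J U where U: "query_map f u J U" using assms(1) unfolding unamb_def by blast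
  note D = query_mapD[OF U]
  have "query_map f v J U"
    unfolding query_map_def
  proof (intro conjI allI impI)
    show "card (U x) \<le> v (f x)" for x using D(4)[of x] assms(2)[of "f x"] by linarith
    show "f y = f x" "U y = U x" if "\<forall>i\<in>U x. y i = x i" for x y
      using D(5)[OF that] by blast+
  qed (rule D)+
  then show ?thesis unfolding unamb_def by blast
qed

section \<open>Renaming variables\<close>

text \<open>A variable outside the range of \<open>e\<close> does not influence the new function:
  such a query is answered arbitrarily and merely lowers the budget. Other queries are passed on to
  the given adversary.\<close>

lemma adversary_reindex:
  fixes e :: "'a \<Rightarrow> 'b"
  assumes "inj e" and "adversary f d (q \<circ> e)"
  shows "adversary (\<lambda>y. f (y \<circ> e)) d q"
  using assms(2)
proof (induction d arbitrary: q)
  case (Suc d)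
  have "\<exists>y. consistent q y \<and> f (y \<circ> e) = b" for b
  proof -
    obtain x where x: "consistent (q \<circ> e) x" "f x = b"
      using adversary_undecided[OF Suc.prems] by blast
    \<comment> \<open>Outside the range of \<open>e\<close> the input follows \<open>q\<close>, with
      \<open>False\<close> where \<open>q\<close> is undefined.\<close>
    define y where "y k = (if k \<in> range e then x (inv e k) else q k = Some True)" for k
    have ye: "y (e i) = x i" for i using assms(1) by (simp add: y_def)
    then have "y \<circ> e = x" by (simp add: fun_eq_iff)
    moreover have "consistent q y"
      unfolding consistent_iff
    proof (intro allI impI)
      fix k b assume k: "q k = Some b"
      show "y k = b"
      proof (cases "k \<in> range e")
        case True
        then obtain i where "k = e i" by blast
        then show ?thesis using k x(1) ye[of i] unfolding consistent_iff by simp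
      next
        case False
        then show ?thesis using k by (simp add: y_def)
      qed
    qed
    ultimately show ?thesis using x(2) by blast
  qed
  moreover have "\<exists>b. adversary (\<lambda>y. f (y \<circ> e)) d (q(k \<mapsto> b))" if "q k = None" for k
  proof (cases "k \<in> range e")
    case True
    then obtain i where i: "k = e i" by auto
    have "(q(k \<mapsto> b)) \<circ> e = (q \<circ> e)(i \<mapsto> b)" for b
      using assms(1) by (simp add: i fun_eq_iff inj_eq)
    moreover have "(q \<circ> e) i = None" using that i by simp
    then obtain b where "adversary f d ((q \<circ> e)(i \<mapsto> b))"
      using adversary_answer[OF Suc.prems] by blast
    ultimately show ?thesis using Suc.IH[of "q(k \<mapsto> b)"] by metis
  next
    case False
    then have "(q(k \<mapsto> True)) \<circ> e = q \<circ> e" by (auto simp: fun_eq_iff)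
    then have "adversary f d ((q(k \<mapsto> True)) \<circ> e)" using adversary_Suc[OF Suc.prems] by metis
    from Suc.IH[OF this] show ?thesis by blast
  qed
  ultimately show ?case unfolding adversary.simps(2) by blast
qed simp

lemma certifies_reindex:
  assumes "certifies f S (y \<circ> e)"
  shows "certifies (\<lambda>y. f (y \<circ> e)) (e ` S) y"
  unfolding certifies_def
proof (intro allI impI)
  fix z assume "\<forall>k\<in>e ` S. z k = y k"
  then have "\<forall>i\<in>S. (z \<circ> e) i = (y \<circ> e) i" by simp
  with assms show "f (z \<circ> e) = f (y \<circ> e)" unfolding certifies_def by blast
qed

lemma certifiable_reindex:
  assumes "certifiable f b w"
  shows "certifiable (\<lambda>y. f (y \<circ> e)) b w"
proof -
  obtain \<S> where "cert_sets f b w \<S>" using assms unfolding certifiable_def by blast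
  note S = cert_setsD[OF this]
  show ?thesis
    unfolding certifiable_def cert_sets_def
  proof (intro exI[of _ "(`) e ` \<S>"] conjI ballI allI impI)
    show "card ((`) e ` \<S>) \<le> 2 ^ w" using S(1,2) card_image_le order_trans by blast
    show "\<exists>S\<in>(`) e ` \<S>. certifies (\<lambda>y. f (y \<circ> e)) S x" if "f (x \<circ> e) = b" for x
      using S(5)[OF that] certifies_reindex by blast
    show "finite S" "card S \<le> w" if "S \<in> (`) e ` \<S>" for S
      using that S(3,4) card_image_le order_trans by blast+
  qed (use S(1) in simp)
qed

lemma unamb_reindex:
  assumes "unamb f u"
  shows "unamb (\<lambda>y. f (y \<circ> e)) u"
proof -
  obtain J U where "query_map f u J U" using assms unfolding unamb_def by blast
  note U = query_mapD[OF this]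
  show ?thesis
    unfolding unamb_def query_map_def
  proof (intro exI[of _ "e ` J"] exI[of _ "\<lambda>y. e ` U (y \<circ> e)"] conjI allI impI)
    show "card (e ` U (x \<circ> e)) \<le> u (f (x \<circ> e))" for x
      using card_image_le[OF U(3)] U(4) order_trans by blast
    show "f (y \<circ> e) = f (x \<circ> e)" "e ` U (y \<circ> e) = e ` U (x \<circ> e)"
      if "\<forall>i\<in>e ` U (x \<circ> e). y i = x i" for x y
    proof -
      have "\<forall>i\<in>U (x \<circ> e). (y \<circ> e) i = (x \<circ> e) i" using that by simp
      from U(5)[OF this] show "f (y \<circ> e) = f (x \<circ> e)" "e ` U (y \<circ> e) = e ` U (x \<circ> e)"
        by blast+
    qed
    show "finite (e ` J)" using U(1) by (rule finite_imageI)
    show "e ` U (x \<circ> e) \<subseteq> e ` J" for x using U(2) by (rule image_mono)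
  qed
qed

text \<open>The preimage of a certificate under \<open>e\<close> certifies \<open>f\<close>, and
  injectivity keeps it from being larger.\<close>

lemma min_cert_reindex:
  assumes "inj e" and "min_cert f s"
  shows "min_cert (\<lambda>y. f (y \<circ> e)) s"
  unfolding min_cert_def
proof (intro allI impI)
  fix x S assume fx: "f (x \<circ> e)" and "finite S" and S: "certifies (\<lambda>y. f (y \<circ> e)) S x"
  have "certifies f (e -` S) (x \<circ> e)"
    unfolding certifies_def
  proof (intro allI impI)
    fix z assume z: "\<forall>i\<in>e -` S. z i = (x \<circ> e) i"
    define y where "y k = (if k \<in> range e then z (inv e k) else x k)" for k
    have "y \<circ> e = z" using assms(1) by (auto simp: y_def)
    moreover have "\<forall>k\<in>S. y k = x k" using z assms(1) by (auto simp: y_def)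
    ultimately show "f z = f (x \<circ> e)" using S unfolding certifies_def by metis
  qed
  moreover have "finite (e -` S)" using \<open>finite S\<close> assms(1) by (rule finite_vimageI)
  ultimately have "s \<le> card (e -` S)" using assms(2) fx unfolding min_cert_def by blast
  also have "\<dots> = card (e ` (e -` S))" using assms(1) by (metis card_image inj_on_subset subset_UNIV)
  also have "\<dots> \<le> card S" using \<open>finite S\<close> by (intro card_mono) auto
  finally show "s \<le> card S" .
qed

section \<open>Composition with conjunctions\<close>

definition conj_comp :: "nat \<Rightarrow> (('i \<Rightarrow> bool) \<Rightarrow> bool) \<Rightarrow> (nat \<times> 'i \<Rightarrow> bool) \<Rightarrow> bool" where
  "conj_comp n f y \<longleftrightarrow> (\<forall>j<n. f (\<lambda>i. y (j, i)))"

lemma consistent_blocks: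
  assumes "\<And>j. j < n \<Longrightarrow> consistent (\<lambda>i. p (j, i)) (x j)"
  shows "consistent p (\<lambda>(j, i). if j < n then x j i else p (j, i) = Some True)"
  using assms unfolding consistent_iff by auto

text \<open>The invariant for the induction: \<open>a j\<close> is the budget left in block
  \<open>j\<close>, and a block with budget 0 is already forced to be true. While some budget is
  positive, setting the other blocks true leaves the conjunction to one undecided block.\<close>

lemma adversary_conj_comp_budget:
  assumes "\<And>j. j < n \<Longrightarrow>
      (if a j = 0 then \<forall>x. consistent (\<lambda>i. p (j, i)) x \<longrightarrow> f x
       else adversary f (a j) (\<lambda>i. p (j, i)))"
    and "d \<le> sum a {..<n}"
  shows "adversary (conj_comp n f) d p"
  using assms
proof (induction d arbitrary: a p)
  case (Suc d)
  note blk = Suc.prems(1)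
  have val: "\<exists>x. consistent (\<lambda>i. p (j, i)) x \<and> f x = b" if "j < n" "b \<or> a j \<noteq> 0" for j b
  proof (cases "a j")
    case 0
    then show ?thesis using blk[OF that(1)] that(2) consistent_default by fastforce
  next
    case (Suc e)
    then show ?thesis using blk[OF that(1)] adversary_undecided[of f "a j"] by simp
  qed
  have ex: "\<exists>y. consistent p y \<and> (\<forall>j<n. f (\<lambda>i. y (j, i)) = B j)"
    if B: "\<And>j. j < n \<Longrightarrow> B j \<or> a j \<noteq> 0" for B
  proof -
    obtain x where "\<And>j. j < n \<Longrightarrow> consistent (\<lambda>i. p (j, i)) (x j) \<and> f (x j) = B j"
      using val[OF _ B] by metis
    then show ?thesis
      using consistent_blocks[of n p x]
      by (intro exI[of _ "\<lambda>(j, i). if j < n then x j i else p (j, i) = Some True"]) auto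
  qed
  have "sum a {..<n} \<noteq> 0" using Suc.prems(2) by linarith
  then obtain j0 where j0: "j0 < n" "a j0 \<noteq> 0" by (auto simp: sum_eq_0_iff)
  have "\<exists>y. consistent p y \<and> conj_comp n f y = b" for b
  proof -
    obtain y where "consistent p y" "\<forall>j<n. f (\<lambda>i. y (j, i)) = (b \<or> j \<noteq> j0)"
      using ex[of "\<lambda>j. b \<or> j \<noteq> j0"] j0(2) by blast
    then show ?thesis using j0(1) unfolding conj_comp_def by (intro exI[of _ y]) auto
  qed
  moreover have "\<exists>b. adversary (conj_comp n f) d (p(k \<mapsto> b))" if "p k = None" for k
  proof -
    obtain j i where k: "k = (j, i)" by (cases k)
    let ?q = "\<lambda>i. p (j, i)"
    have qi: "?q i = None" using that k by simp
    have other: "(\<lambda>i'. (p(k \<mapsto> b)) (j', i')) = (\<lambda>i'. p (j', i'))" if "j' \<noteq> j" for j' b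
      using that k by auto
    have same: "(\<lambda>i'. (p(k \<mapsto> b)) (j, i')) = ?q(i \<mapsto> b)" for b
      using k by auto
    \<comment> \<open>One query lowers the budget of its block, and hence the sum, by at most
      one.\<close>
    have step: "adversary (conj_comp n f) d (p(k \<mapsto> b))"
      if le: "a j \<le> Suc e" and new: "j < n \<Longrightarrow> if e = 0 then \<forall>x. consistent (?q(i \<mapsto> b)) x \<longrightarrow> f x
          else adversary f e (?q(i \<mapsto> b))" for e b
    proof (rule Suc.IH[of "a(j := e)"])
      show "if (a(j := e)) j' = 0 then \<forall>x. consistent (\<lambda>i'. (p(k \<mapsto> b)) (j', i')) x \<longrightarrow> f x
          else adversary f ((a(j := e)) j') (\<lambda>i'. (p(k \<mapsto> b)) (j', i'))" if "j' < n" for j'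
      proof (cases "j' = j")
        case True
        then show ?thesis using new that same by simp
      next
        case False
        then show ?thesis using blk[OF that] other by simp
      qed
      have "sum a {..<n} \<le> Suc (sum (a(j := e)) {..<n})"
      proof (cases "j < n")
        case True
        have "sum a {..<n} = a j + sum a ({..<n} - {j})"
          using True by (simp add: sum.remove)
        moreover have "sum (a(j := e)) {..<n} = e + sum a ({..<n} - {j})"
          using True by (simp add: sum.remove)
        ultimately show ?thesis using le by linarith
      next
        case False
        then have "sum (a(j := e)) {..<n} = sum a {..<n}" by (intro sum.cong) auto
        then show ?thesis by simp
      qed
      then show "d \<le> sum (a(j := e)) {..<n}" using Suc.prems(2) by linarith
    qed
    consider "\<not> j < n" | "j < n" "a j = 0" | "j < n" "a j = 1"
      | e where "j < n" "a j = Suc e" "e \<noteq> 0"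
      by (metis One_nat_def not0_implies_Suc)
    then show ?thesis
    proof cases
      case 1
      then show ?thesis using step[of "a j" True] by (intro exI[of _ True]) simp
    next
      case 2
      then have "\<forall>x. consistent ?q x \<longrightarrow> f x" using blk[of j] by simp
      then have "\<forall>x. consistent (?q(i \<mapsto> True)) x \<longrightarrow> f x"
        using consistent_update[of ?q i, OF _ qi] by blast
      then show ?thesis using step[of 0 True] 2(2) by (intro exI[of _ True]) simp
    next
      \<comment> \<open>At the last unit of a block the answer follows an input with value true.
        Either this forces the block to be true, and budget 0 is right, or both values remain
        possible, and budget 1 is kept.\<close>
      case 3
      then obtain x where x: "consistent ?q x" "f x"
        using blk[of j] adversary_undecided[of f "a j" ?q True] by auto
      have cx: "consistent (?q(i \<mapsto> x i)) x" using x(1) unfolding consistent_iff by auto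
      show ?thesis
      proof (cases "\<forall>z. consistent (?q(i \<mapsto> x i)) z \<longrightarrow> f z")
        case True
        then show ?thesis using step[of 0 "x i"] 3(2) by (intro exI[of _ "x i"]) simp
      next
        case False
        then have "\<exists>z. consistent (?q(i \<mapsto> x i)) z \<and> f z = b" for b
          using cx x(2) by (cases b) blast+
        then have "adversary f 1 (?q(i \<mapsto> x i))" by simp
        then show ?thesis using step[of 1 "x i"] 3(2) by (intro exI[of _ "x i"]) simp
      qed
    next
      case 4
      then obtain b where "adversary f e (?q(i \<mapsto> b))"
        using blk[of j] adversary_answer[of f e ?q i] qi by auto
      then show ?thesis using step[of e b] 4(2,3) by (intro exI[of _ b]) simp
    qed
  qed
  ultimately show ?case unfolding adversary.simps(2) by blast
qed simp

lemma adversary_conj_comp: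
  assumes "adversary f d Map.empty" and "d > 0"
  shows "adversary (conj_comp n f) (n * d) Map.empty"
  using assms by (intro adversary_conj_comp_budget[where a = "\<lambda>_. d"]) auto

lemma card_Sigma_le:
  fixes B :: "nat \<Rightarrow> 'b set"
  assumes "\<And>j. j < n \<Longrightarrow> finite (B j)" and "\<And>j. j < n \<Longrightarrow> card (B j) \<le> w"
  shows "card (Sigma {..<n} B) \<le> n * w"
proof -
  have "card (Sigma {..<n} B) = (\<Sum>j<n. card (B j))" using assms(1) by (intro card_SigmaI) auto
  also have "\<dots> \<le> n * w" using sum_bounded_above[of "{..<n}" "\<lambda>j. card (B j)" w] assms(2) by auto
  finally show ?thesis .
qed

text \<open>One set is chosen in each block independently. Lengths add up to \<open>n * w\<close>,
  and so do the bits of the names, since there are at most \<open>(2 ^ w) ^ n\<close>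
  choices.\<close>

lemma certifiable_conj_comp_True:
  assumes "certifiable f True w"
  shows "certifiable (conj_comp n f) True (n * w)"
proof -
  obtain \<S> where "cert_sets f True w \<S>" using assms unfolding certifiable_def by blast
  note S = cert_setsD[OF this]
  let ?F = "Sigma {..<n} ` ({..<n} \<rightarrow>\<^sub>E \<S>)"
  show ?thesis
    unfolding certifiable_def cert_sets_def
  proof (intro exI[of _ ?F] conjI ballI allI impI)
    have fin: "finite ({..<n} \<rightarrow>\<^sub>E \<S>)" using S(1) by (intro finite_PiE) auto
    then show "finite ?F" by simp
    have "card ?F \<le> card ({..<n} \<rightarrow>\<^sub>E \<S>)" using fin by (rule card_image_le)
    also have "\<dots> = card \<S> ^ n" by (simp add: card_PiE)
    also have "\<dots> \<le> (2 ^ w) ^ n" using S(2) by (rule power_mono) simp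
    finally show "card ?F \<le> 2 ^ (n * w)" by (simp add: power_mult[symmetric] mult.commute)
  next
    fix S assume "S \<in> ?F"
    then obtain Q where "S = Sigma {..<n} Q" "\<And>j. j < n \<Longrightarrow> Q j \<in> \<S>" by auto
    moreover from this have "finite (Q j)" "card (Q j) \<le> w" if "j < n" for j
      using S(3,4) that by simp_all
    ultimately show "finite S" "card S \<le> n * w"
      using card_Sigma_le[of n Q w] by auto
  next
    fix y assume y: "conj_comp n f y = True"
    then have "\<forall>j<n. \<exists>S\<in>\<S>. certifies f S (\<lambda>i. y (j, i))"
      using S(5) unfolding conj_comp_def by simp
    then obtain Q where Q: "\<And>j. j < n \<Longrightarrow> Q j \<in> \<S> \<and> certifies f (Q j) (\<lambda>i. y (j, i))"
      by metis
    show "\<exists>S\<in>?F. certifies (conj_comp n f) S y"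
    proof (intro bexI[of _ "Sigma {..<n} (restrict Q {..<n})"])
      show "certifies (conj_comp n f) (Sigma {..<n} (restrict Q {..<n})) y"
        unfolding certifies_def
      proof (intro allI impI)
        fix z assume z: "\<forall>k\<in>Sigma {..<n} (restrict Q {..<n}). z k = y k"
        have "f (\<lambda>i. z (j, i)) = f (\<lambda>i. y (j, i))" if "j < n" for j
        proof -
          have "\<forall>i\<in>Q j. z (j, i) = y (j, i)" using z that by simp
          with Q[OF that, THEN conjunct2] show ?thesis by (rule certifiesD)
        qed
        then show "conj_comp n f z = conj_comp n f y" unfolding conj_comp_def by simp
      qed
    qed (use Q in auto)
  qed
qed

text \<open>A certificate in one false block suffices; naming that block costs \<open>m\<close>
  further bits.\<close>

lemma certifiable_conj_comp_False:
  assumes "certifiable f False w" and "n \<le> 2 ^ m"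
  shows "certifiable (conj_comp n f) False (w + m)"
proof -
  obtain \<S> where "cert_sets f False w \<S>" using assms(1) unfolding certifiable_def by blast
  note S = cert_setsD[OF this]
  let ?F = "(\<lambda>(j, S). {j} \<times> S) ` ({..<n} \<times> \<S>)"
  show ?thesis
    unfolding certifiable_def cert_sets_def
  proof (intro exI[of _ ?F] conjI ballI allI impI)
    show "finite ?F" using S(1) by simp
    have "card ?F \<le> card ({..<n} \<times> \<S>)" using S(1) by (intro card_image_le) simp
    also have "\<dots> \<le> 2 ^ m * 2 ^ w"
      unfolding card_cartesian_product using S(2) assms(2) by (intro mult_mono) auto
    finally show "card ?F \<le> 2 ^ (w + m)" by (simp add: power_add mult.commute)
  next
    fix S assume "S \<in> ?F"
    then obtain j T where "S = {j} \<times> T" "T \<in> \<S>" by auto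
    then show "finite S" "card S \<le> w + m"
      using S(3,4)[of T] by (simp_all add: card_cartesian_product_singleton)
  next
    fix y assume "conj_comp n f y = False"
    then obtain j where j: "j < n" "\<not> f (\<lambda>i. y (j, i))" unfolding conj_comp_def by auto
    then obtain S where s: "S \<in> \<S>" "certifies f S (\<lambda>i. y (j, i))"
      using S(5)[of "\<lambda>i. y (j, i)"] by auto
    have "certifies (conj_comp n f) ({j} \<times> S) y"
      unfolding certifies_def
    proof (intro allI impI)
      fix z assume "\<forall>k\<in>{j} \<times> S. z k = y k"
      then have "\<forall>i\<in>S. z (j, i) = y (j, i)" by simp
      with s(2) have "f (\<lambda>i. z (j, i)) = f (\<lambda>i. y (j, i))" by (rule certifiesD)
      then show "conj_comp n f z = conj_comp n f y" using j unfolding conj_comp_def by blast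
    qed
    moreover have "{j} \<times> S \<in> ?F" using j(1) s(1) by (intro image_eqI[of _ _ "(j, S)"]) auto
    ultimately show "\<exists>S\<in>?F. certifies (conj_comp n f) S y" by (rule bexI)
  qed
qed

text \<open>Blocks are read in order up to and including the first false one. What has been read
  determines where the reading stops, so the certificates are unambiguous, and at most one block
  contributes a 0-certificate.\<close>

lemma unamb_conj_comp:
  assumes "unamb f u"
  shows "unamb (conj_comp n f) (\<lambda>b. n * u True + (if b then 0 else u False))"
proof -
  obtain J U where "query_map f u J U" using assms unfolding unamb_def by blast
  note U = query_mapD[OF this]
  let ?b = "\<lambda>y j i. y (j, i)"
  define V where "V y = (SIGMA j:{j. j < n \<and> (\<forall>l<j. f (?b y l))}. U (?b y j))" for y
  have fst_f: "f (?b z j) = f (?b y j) \<and> U (?b z j) = U (?b y j)"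
    if "\<forall>k\<in>V y. z k = y k" "j < n" "\<forall>l<j. f (?b y l)" for y z j
  proof -
    have "\<forall>i\<in>U (?b y j). ?b z j i = ?b y j i" using that unfolding V_def by blast
    from U(5)[OF this] show ?thesis .
  qed
  \<comment> \<open>Agreement on \<open>V y\<close> propagates from block to block: as long as the
    earlier blocks are true, \<open>V y\<close> covers the next one as well.\<close>
  have pre: "(\<forall>l<j. f (?b z l)) = (\<forall>l<j. f (?b y l))"
    if "\<forall>k\<in>V y. z k = y k" "j \<le> n" for y z j
    using that(2)
  proof (induction j)
    case (Suc j)
    then have "(\<forall>l<j. f (?b z l)) = (\<forall>l<j. f (?b y l))" by simp
    moreover have "\<forall>l<j. f (?b y l) \<Longrightarrow> f (?b z j) = f (?b y j)"
      using fst_f[OF that(1), of j] Suc.prems by simp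
    ultimately show ?case unfolding less_Suc_eq by blast
  qed simp
  show ?thesis
    unfolding unamb_def query_map_def
  proof (intro exI[of _ "{..<n} \<times> J"] exI[of _ V] conjI allI impI)
    show "finite ({..<n} \<times> J)" using U(1) by simp
    show "V y \<subseteq> {..<n} \<times> J" for y using U(2) unfolding V_def by blast
    show "conj_comp n f z = conj_comp n f y" if "\<forall>k\<in>V y. z k = y k" for y z
      using pre[OF that, of n] unfolding conj_comp_def by blast
    show "V z = V y" if "\<forall>k\<in>V y. z k = y k" for y z
    proof -
      have "{j. j < n \<and> (\<forall>l<j. f (?b z l))} = {j. j < n \<and> (\<forall>l<j. f (?b y l))}"
        using pre[OF that] by (intro Collect_cong) (metis less_imp_le)
      then show ?thesis
        unfolding V_def
      proof (rule Sigma_cong)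
        show "U (?b z j) = U (?b y j)" if "j \<in> {j. j < n \<and> (\<forall>l<j. f (?b y l))}" for j
          using fst_f[OF \<open>\<forall>k\<in>V y. z k = y k\<close>] that by blast
      qed
    qed
  next
    fix y
    show "card (V y) \<le> n * u True + (if conj_comp n f y then 0 else u False)"
    proof (cases "conj_comp n f y")
      case True
      then have "V y = Sigma {..<n} (\<lambda>j. U (?b y j))"
        unfolding V_def conj_comp_def by auto
      also have "card \<dots> \<le> n * u True"
      proof (rule card_Sigma_le[OF U(3)])
        show "card (U (?b y l)) \<le> u True" if "l < n" for l
          using U(4)[of "?b y l"] True that unfolding conj_comp_def by simp
      qed
      finally show ?thesis using True by simp
    next
      case False
      then obtain i where i: "i < n" "\<not> f (?b y i)" unfolding conj_comp_def by auto
      define j where "j = (LEAST j. \<not> f (?b y j))"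
      have "\<not> f (?b y j)" unfolding j_def using i(2) by (rule LeastI)
      moreover have "\<forall>l<j. f (?b y l)" unfolding j_def using not_less_Least by blast
      moreover have "j \<le> i" unfolding j_def using i(2) by (rule Least_le)
      ultimately have j: "j < n" "\<not> f (?b y j)" "\<forall>l<j. f (?b y l)" using i(1) by auto
      have "V y \<subseteq> Sigma {..<j} (\<lambda>j. U (?b y j)) \<union> {j} \<times> U (?b y j)"
      proof (rule subsetI)
        fix k assume "k \<in> V y"
        then obtain l i where k: "k = (l, i)" "\<forall>l'<l. f (?b y l')" "i \<in> U (?b y l)"
          unfolding V_def by blast
        have "\<not> j < l" using k(2) j(2) by blast
        then have "l < j \<or> l = j" by linarith
        then show "k \<in> Sigma {..<j} (\<lambda>j. U (?b y j)) \<union> {j} \<times> U (?b y j)"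
          using k(1,3) by blast
      qed
      then have "card (V y) \<le> card (Sigma {..<j} (\<lambda>j. U (?b y j)) \<union> {j} \<times> U (?b y j))"
        using U(3) by (intro card_mono) auto
      also have "\<dots> \<le> card (Sigma {..<j} (\<lambda>j. U (?b y j))) + card ({j} \<times> U (?b y j))"
        by (rule card_Un_le)
      also have "\<dots> \<le> j * u True + u False"
      proof (rule add_mono)
        show "card (Sigma {..<j} (\<lambda>j. U (?b y j))) \<le> j * u True"
        proof (rule card_Sigma_le[OF U(3)])
          show "card (U (?b y l)) \<le> u True" if "l < j" for l
            using U(4)[of "?b y l"] j(3) that by simp
        qed
        show "card ({j} \<times> U (?b y j)) \<le> u False"
          using U(4)[of "?b y j"] j(2) by (simp add: card_cartesian_product_singleton)
      qed
      also have "\<dots> \<le> n * u True + u False" using j(1) by simp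
      finally show ?thesis using False by simp
    qed
  qed
qed

text \<open>A block avoided by \<open>S\<close> could be replaced by the false input
  \<open>x\<close>, so \<open>S\<close> meets all \<open>n\<close> blocks.\<close>

lemma min_cert_conj_comp:
  assumes "\<not> f x"
  shows "min_cert (conj_comp n f) n"
  unfolding min_cert_def
proof (intro allI impI)
  fix y S assume y: "conj_comp n f y" and S: "finite S" "certifies (conj_comp n f) S y"
  have "j \<in> fst ` S" if j: "j < n" for j
  proof (rule ccontr)
    assume nj: "j \<notin> fst ` S"
    let ?z = "\<lambda>(l, i). if l = j then x i else y (l, i)"
    have "\<forall>k\<in>S. ?z k = y k" using nj by force
    then have "conj_comp n f ?z" using S(2) y unfolding certifies_def by blast
    then have "f (\<lambda>i. ?z (j, i))" using j unfolding conj_comp_def by blast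
    then show False using assms by simp
  qed
  then have "card {..<n} \<le> card (fst ` S)" using S(1) by (intro card_mono) auto
  then show "n \<le> card S" using card_image_le[OF S(1), of fst] by simp
qed

section \<open>Cheat sheets\<close>

text \<open>
  An input consists of \<open>c\<close> inputs of \<open>f\<close> (the blocks) and \<open>2 ^ c\<close> cells, addressed by the
  values of \<open>f\<close> on the blocks. The addressed cell must name, through the decoder \<open>dec\<close>, sets of
  positions that certify these values. The empty set certifies nothing, so it acts as the
  invalid entry of a cell.
\<close>

type_synonym 'i sheet = "(nat \<times> 'i) + (bool list \<times> nat \<times> nat)"

definition block :: "('i sheet \<Rightarrow> bool) \<Rightarrow> nat \<Rightarrow> 'i \<Rightarrow> bool" where
  "block y j = (\<lambda>i. y (Inl (j, i)))"

text \<open>\<open>\<A>\<close> contains certificates for both values of \<open>f\<close>. As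
  \<open>dec\<close> maps the \<open>T\<close>-bit words onto \<open>\<A>\<close>, every member,
  including the invalid empty entry, can be written in a cell.\<close>

locale cheat_sheet =
  fixes f :: "('i \<Rightarrow> bool) \<Rightarrow> bool" and c T :: nat
    and \<A> :: "'i set set" and dec :: "nat set \<Rightarrow> 'i set"
  assumes card_A: "card \<A> \<le> 2 ^ T"
    and finite_certs: "A \<in> \<A> \<Longrightarrow> finite A" and card_certs: "A \<in> \<A> \<Longrightarrow> card A \<le> T"
    and certs: "\<exists>S\<in>\<A>. certifies f S x"
    and dec: "dec ` Pow {..<T} = \<A>" and empty_A: "{} \<in> \<A>"
    and c_pos: "0 < c"
begin

definition label :: "('i sheet \<Rightarrow> bool) \<Rightarrow> bool list" where
  "label y = map (\<lambda>j. f (block y j)) [0..<c]"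

definition content :: "('i sheet \<Rightarrow> bool) \<Rightarrow> nat \<Rightarrow> nat set" where
  "content y j = {t. t < T \<and> y (Inr (label y, j, t))}"

definition cheat :: "('i sheet \<Rightarrow> bool) \<Rightarrow> bool" where
  "cheat y \<longleftrightarrow> (\<forall>j<c. certifies f (dec (content y j)) (block y j))"

definition cell :: "bool list \<Rightarrow> 'i sheet set" where
  "cell l = Inr ` ({l} \<times> {..<c} \<times> {..<T})"

abbreviation labels :: "bool list set" where
  "labels \<equiv> {l. set l \<subseteq> UNIV \<and> length l = c}"

lemma finite_A: "finite \<A>"
  unfolding dec[symmetric] by simp

lemma dec_content: "dec (content y j) \<in> \<A>"
  unfolding dec[symmetric] content_def by (intro imageI) auto

lemma label_in: "label y \<in> labels"
  unfolding label_def by simp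

lemma finite_labels: "finite labels" and card_labels: "card labels = 2 ^ c"
  using finite_lists_length_eq[of "UNIV :: bool set" c] card_lists_length_eq[of "UNIV :: bool set" c]
  by simp_all

lemma finite_cell: "finite (cell l)"
  unfolding cell_def by simp

lemma card_cell: "card (cell l) = c * T"
  unfolding cell_def by (subst card_image) (auto simp: card_cartesian_product)

text \<open>Agreement on the addressed cell and the decoded positions does not preserve the label by
  itself, because the sets decoded from an invalid cell may certify nothing. The values on the
  blocks are therefore a separate hypothesis, which each use obtains from certificates of its
  own.\<close>

lemma cheat_stable:
  assumes "\<forall>k\<in>cell (label y). z k = y k"
    and "\<forall>j<c. \<forall>i\<in>dec (content y j). block z j i = block y j i"
    and "\<forall>j<c. f (block z j) = f (block y j)"
  shows "label z = label y" and "\<And>j. j < c \<Longrightarrow> content z j = content y j"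
    and "cheat z = cheat y"
proof -
  show l: "label z = label y" unfolding label_def using assms(3) by simp
  show con: "content z j = content y j" if "j < c" for j
  proof -
    have "z (Inr (label y, j, t)) = y (Inr (label y, j, t))" if "t < T" for t
      using assms(1) \<open>j < c\<close> that unfolding cell_def by auto
    then show ?thesis unfolding content_def l by (simp cong: conj_cong)
  qed
  show "cheat z = cheat y"
    unfolding cheat_def
  proof (rule all_cong)
    fix j assume j: "j < c"
    show "certifies f (dec (content z j)) (block z j) = certifies f (dec (content y j)) (block y j)"
      unfolding con[OF j]
      using certifies_cong[of "dec (content y j)" "block z j" "block y j" f] assms(2,3) j by blast
  qed
qed

section \<open>Query lower bound for the cheat sheet function\<close>

definition touched :: "('i sheet \<rightharpoonup> bool) \<Rightarrow> bool list set" where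
  "touched p = {l \<in> labels. \<exists>j t. p (Inr (l, j, t)) \<noteq> None}"

text \<open>Some cell is still untouched. Its address can be realised by the undecided blocks, and
  it can then be filled with genuine certificates or with empty sets, according to
  \<open>b\<close>.\<close>

lemma undecided_sheet:
  assumes blocks: "\<And>j b. j < c \<Longrightarrow> \<exists>x. consistent (block_of p j) x \<and> f x = b"
    and block_of: "\<And>j. block_of p j = (\<lambda>i. p (Inl (j, i)))"
    and fresh: "card (touched p) < 2 ^ c"
  shows "\<exists>y. consistent p y \<and> cheat y = b"
proof -
  have "touched p \<subseteq> labels" unfolding touched_def by blast
  moreover have "touched p \<noteq> labels" using fresh card_labels by auto
  ultimately obtain l where l: "l \<in> labels" "l \<notin> touched p" by blast
  then have none: "p (Inr (l, j, t)) = None" for j t unfolding touched_def by blast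
  obtain x where x: "\<And>j. j < c \<Longrightarrow> consistent (block_of p j) (x j) \<and> f (x j) = l ! j"
  proof -
    have "\<exists>x. j < c \<longrightarrow> consistent (block_of p j) x \<and> f x = l ! j" for j
      using blocks[of j "l ! j"] by blast
    then show ?thesis using that by metis
  qed
  have "\<exists>q. q \<subseteq> {..<T} \<and> (j < c \<longrightarrow> certifies f (dec q) (x j) = b)" for j
  proof (cases b)
    case True
    obtain S where S: "S \<in> \<A>" "certifies f S (x j)" using certs by blast
    from S(1) obtain q where "q \<in> Pow {..<T}" "S = dec q" unfolding dec[symmetric] by blast
    then show ?thesis using S(2) True by (intro exI[of _ q]) simp
  next
    case False
    from empty_A obtain q where q: "q \<in> Pow {..<T}" "{} = dec q" unfolding dec[symmetric] by blast
    \<comment> \<open>The empty set certifies only constant functions, and both values still occur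
      in this block.\<close>
    have "\<not> certifies f {} (x j)" if "j < c"
    proof
      assume "certifies f {} (x j)"
      then have "f z = f (x j)" for z by (rule certifiesD) simp
      then show False using blocks[OF that, of "\<not> f (x j)"] by blast
    qed
    then show ?thesis using q False by (intro exI[of _ q]) auto
  qed
  then obtain q where q: "\<And>j. q j \<subseteq> {..<T}" "\<And>j. j < c \<Longrightarrow> certifies f (dec (q j)) (x j) = b"
    by metis
  define y :: "'i sheet \<Rightarrow> bool" where
    "y k = (case k of Inl (j, i) \<Rightarrow> if j < c then x j i else p k = Some True
            | Inr (l', j, t) \<Rightarrow> if l' = l then t \<in> q j else p k = Some True)" for k
  have blk: "block y j = x j" if "j < c" for j
    unfolding block_def y_def using that by simp
  have lab: "label y = l"
    unfolding label_def using l(1) x blk by (intro nth_equalityI) auto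
  have con: "content y j = q j" for j
    unfolding content_def lab y_def using q(1)[of j] by auto
  \<comment> \<open>An invalid sheet needs at least one block whose entry fails, whence
    \<open>c_pos\<close>.\<close>
  have "cheat y = b"
    unfolding cheat_def con using q(2) blk c_pos by (cases b) auto
  moreover have "consistent p y"
    unfolding consistent_iff
  proof (intro allI impI)
    fix k v assume k: "p k = Some v"
    show "y k = v"
    proof (cases k)
      case (Inl ji)
      obtain j i where "ji = (j, i)" by (cases ji)
      then show ?thesis
        using k x[of j] Inl unfolding y_def consistent_iff block_of by auto
    next
      case (Inr ljt)
      obtain l' j t where "ljt = (l', j, t)" by (cases ljt)
      then show ?thesis using k Inr none[of j t] unfolding y_def by auto
    qed
  qed
  ultimately show ?thesis by blast
qed

text \<open>A query in a block is answered by the adversary for \<open>f\<close>; a query in a cell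
  is answered arbitrarily and touches at most one new cell. In both cases the budget of every block
  may drop by one, so block budgets stay at least \<open>d\<close> and fewer than
  \<open>2 ^ c\<close> cells are touched while queries remain.\<close>

lemma adversary_cheat:
  assumes "\<And>j. j < c \<Longrightarrow> adversary f d (\<lambda>i. p (Inl (j, i)))"
    and "card (touched p) + d \<le> 2 ^ c"
  shows "adversary cheat d p"
  using assms
proof (induction d arbitrary: p)
  case (Suc d)
  have "\<exists>y. consistent p y \<and> cheat y = b" for b
    using adversary_undecided[OF Suc.prems(1)] Suc.prems(2)
    by (intro undecided_sheet[of "\<lambda>p j i. p (Inl (j, i))"]) auto
  moreover have "\<exists>b. adversary cheat d (p(k \<mapsto> b))" if "p k = None" for k
  proof (cases k)
    case (Inl ji)
    obtain j i where ji: "ji = (j, i)" by (cases ji)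
    have touched: "touched (p(k \<mapsto> b)) = touched p" for b
      unfolding touched_def Inl by simp
    have other: "(\<lambda>i'. (p(k \<mapsto> b)) (Inl (j', i'))) = (\<lambda>i'. p (Inl (j', i')))" if "j' \<noteq> j" for j' b
      using that unfolding Inl ji by simp
    have same: "(\<lambda>i'. (p(k \<mapsto> b)) (Inl (j, i'))) = (\<lambda>i'. p (Inl (j, i')))(i \<mapsto> b)" for b
      unfolding Inl ji by (simp add: fun_eq_iff)
    have "\<exists>b. j < c \<longrightarrow> adversary f d ((\<lambda>i'. p (Inl (j, i')))(i \<mapsto> b))"
      using adversary_answer[OF Suc.prems(1), of j i] that unfolding Inl ji by blast
    then obtain b where b: "j < c \<longrightarrow> adversary f d ((\<lambda>i'. p (Inl (j, i')))(i \<mapsto> b))" by blast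
    have "adversary cheat d (p(k \<mapsto> b))"
    proof (rule Suc.IH)
      show "adversary f d (\<lambda>i'. (p(k \<mapsto> b)) (Inl (j', i')))" if "j' < c" for j'
      proof (cases "j' = j")
        case True
        then show ?thesis using b same that by simp
      next
        case False
        then show ?thesis
          unfolding other[OF False] using adversary_Suc[OF Suc.prems(1)[OF that]] by simp
      qed
      show "card (touched (p(k \<mapsto> b))) + d \<le> 2 ^ c" using Suc.prems(2) touched by simp
    qed
    then show ?thesis by blast
  next
    case (Inr ljt)
    have same: "(\<lambda>i. (p(k \<mapsto> True)) (Inl (j, i))) = (\<lambda>i. p (Inl (j, i)))" for j
      unfolding Inr by simp
    have "finite (touched p)"
      by (rule finite_subset[OF _ finite_labels]) (auto simp: touched_def)
    moreover have "touched (p(k \<mapsto> True)) \<subseteq> insert (fst ljt) (touched p)"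
      unfolding touched_def Inr by auto
    ultimately have "card (touched (p(k \<mapsto> True))) \<le> Suc (card (touched p))"
      using card_mono[of "insert (fst ljt) (touched p)" "touched (p(k \<mapsto> True))"]
        card_insert_le_m1[of "Suc (card (touched p))" "touched p" "fst ljt"] by simp
    then have "card (touched (p(k \<mapsto> True))) + d \<le> 2 ^ c" using Suc.prems(2) by linarith
    moreover have "adversary f d (\<lambda>i. (p(k \<mapsto> True)) (Inl (j, i)))" if "j < c" for j
      unfolding same using Suc.prems(1)[OF that] by (rule adversary_Suc)
    ultimately have "adversary cheat d (p(k \<mapsto> True))" by (intro Suc.IH)
    then show ?thesis by blast
  qed
  ultimately show ?case unfolding adversary.simps(2) by blast
qed simp

section \<open>Ordinary and unambiguous certificates of the cheat sheet function\<close>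

lemma card_sheet_set:
  assumes "\<And>j. j < c \<Longrightarrow> finite (Q j)" and "\<And>j. j < c \<Longrightarrow> card (Q j) \<le> w"
  shows "card (cell l \<union> Inl ` Sigma {..<c} Q) \<le> c * (T + w)"
proof -
  have fin: "finite (Sigma {..<c} Q)" using assms(1) by blast
  have "card (cell l \<union> Inl ` Sigma {..<c} Q) \<le> card (cell l) + card (Inl ` Sigma {..<c} Q :: 'i sheet set)"
    by (rule card_Un_le)
  also have "\<dots> \<le> c * T + c * w"
  proof -
    have "card (Inl ` Sigma {..<c} Q :: 'i sheet set) \<le> card (Sigma {..<c} Q)"
      using fin by (rule card_image_le)
    also have "\<dots> \<le> c * w" using assms by (rule card_Sigma_le)
    finally show ?thesis unfolding card_cell by simp
  qed
  finally show ?thesis by (simp add: distrib_left)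
qed

lemma agree_blocks:
  assumes "\<forall>k\<in>cell l \<union> Inl ` Sigma {..<c} Q. z k = y k" and "j < c"
  shows "\<forall>i\<in>Q j. block z j i = block y j i"
  using assms unfolding block_def by auto

text \<open>The certificate reads the addressed cell and, in each block, the decoded set together
  with a genuine certificate that fixes the label. Its length is at most \<open>c * (3 * T)\<close>;
  its set of positions is named by a label and two members of \<open>\<A>\<close> per block, which
  takes \<open>c + 2 * T * c\<close> bits. The stated bound covers both.\<close>

lemma certifiable_cheat: "certifiable cheat b (c * (3 * T + 1))"
proof -
  let ?B = "(\<lambda>(A, S). A \<union> S) ` (\<A> \<times> \<A>)"
  let ?F = "(\<lambda>(l, Q). cell l \<union> Inl ` Sigma {..<c} Q) ` (labels \<times> ({..<c} \<rightarrow>\<^sub>E ?B))"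
  have fin: "finite (labels \<times> ({..<c} \<rightarrow>\<^sub>E ?B))"
    using finite_labels finite_A by (intro finite_cartesian_product finite_PiE) simp_all
  have "card ?B \<le> card (\<A> \<times> \<A>)" using finite_A by (intro card_image_le) simp
  also have "\<dots> \<le> 2 ^ T * 2 ^ T"
    unfolding card_cartesian_product using card_A by (intro mult_mono) simp_all
  finally have card_B: "card ?B \<le> 2 ^ (T + T)" by (simp add: power_add)
  have B: "finite Q" "card Q \<le> 2 * T" if "Q \<in> ?B" for Q
  proof -
    obtain AS where "AS \<in> \<A> \<times> \<A>" "Q = (\<lambda>(A, S). A \<union> S) AS" using \<open>Q \<in> ?B\<close> by (rule imageE)
    then have Q: "Q = fst AS \<union> snd AS" "fst AS \<in> \<A>" "snd AS \<in> \<A>" by auto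
    show "finite Q" using Q finite_certs by simp
    have "card Q \<le> card (fst AS) + card (snd AS)" unfolding Q(1) by (rule card_Un_le)
    then show "card Q \<le> 2 * T" using card_certs[OF Q(2)] card_certs[OF Q(3)] by simp
  qed
  have "cert_sets cheat b (c * (3 * T + 1)) ?F"
    unfolding cert_sets_def
  proof (intro conjI ballI allI impI)
    show "finite ?F" using fin by (rule finite_imageI)
    have "card ?F \<le> card (labels \<times> ({..<c} \<rightarrow>\<^sub>E ?B))" using fin by (rule card_image_le)
    also have "\<dots> = 2 ^ c * card ?B ^ c"
      unfolding card_cartesian_product card_labels by (simp add: card_PiE)
    also have "\<dots> \<le> 2 ^ c * (2 ^ (T + T)) ^ c" using card_B by (intro mult_left_mono power_mono) simp_all
    also have "\<dots> = 2 ^ (c + (T + T) * c)" by (simp only: power_add power_mult)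
    also have "\<dots> \<le> 2 ^ (c * (3 * T + 1))" by (intro power_increasing) (simp_all add: algebra_simps)
    finally show "card ?F \<le> 2 ^ (c * (3 * T + 1))" .
  next
    fix S assume "S \<in> ?F"
    then obtain l Q where S: "S = cell l \<union> Inl ` Sigma {..<c} Q" and "Q \<in> {..<c} \<rightarrow>\<^sub>E ?B" by auto
    then have Q: "finite (Q j)" "card (Q j) \<le> 2 * T" if "j < c" for j
      using B[of "Q j"] that by (meson PiE_mem lessThan_iff)+
    have "finite (Sigma {..<c} Q)" using Q(1) by blast
    then show "finite S" unfolding S using finite_cell by simp
    have "card S \<le> c * (T + 2 * T)" unfolding S using Q by (rule card_sheet_set)
    also have "\<dots> \<le> c * (3 * T + 1)" by simp
    finally show "card S \<le> c * (3 * T + 1)" .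
  next
    fix y assume "cheat y = b"
    have "\<exists>S. S \<in> \<A> \<and> certifies f S (block y j)" for j using certs by blast
    then obtain S where S: "\<And>j. S j \<in> \<A>" "\<And>j. certifies f (S j) (block y j)" by metis
    let ?Q = "\<lambda>j\<in>{..<c}. dec (content y j) \<union> S j"
    show "\<exists>S\<in>?F. certifies cheat S y"
    proof (rule bexI[of _ "cell (label y) \<union> Inl ` Sigma {..<c} ?Q"])
      have "?Q \<in> {..<c} \<rightarrow>\<^sub>E ?B"
      proof (rule PiE_I)
        show "?Q j \<in> ?B" if "j \<in> {..<c}" for j
          using that dec_content[of y j] S(1)[of j]
          by (intro image_eqI[of _ _ "(dec (content y j), S j)"]) simp_all
      qed simp
      then show "cell (label y) \<union> Inl ` Sigma {..<c} ?Q \<in> ?F"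
        using label_in[of y] by (intro image_eqI[of _ _ "(label y, ?Q)"]) simp_all
      show "certifies cheat (cell (label y) \<union> Inl ` Sigma {..<c} ?Q) y"
        unfolding certifies_def
      proof (intro allI impI)
        fix z assume z: "\<forall>k\<in>cell (label y) \<union> Inl ` Sigma {..<c} ?Q. z k = y k"
        have Q: "\<forall>i\<in>dec (content y j) \<union> S j. block z j i = block y j i" if "j < c" for j
          using agree_blocks[OF z that] that by simp
        show "cheat z = cheat y"
        proof (rule cheat_stable(3))
          show "\<forall>k\<in>cell (label y). z k = y k" using z by blast
          show "\<forall>j<c. \<forall>i\<in>dec (content y j). block z j i = block y j i" using Q by blast
          have "f (block z j) = f (block y j)" if "j < c" for j
            by (rule certifiesD[OF S(2)]) (use Q[OF that] in blast)
          then show "\<forall>j<c. f (block z j) = f (block y j)" by blast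
        qed
      qed
    qed
  qed
  then show ?thesis unfolding certifiable_def by blast
qed

text \<open>On a 1-input the decoded sets certify the label themselves, so the cell and these sets
  suffice; this is the gain of the construction. On a 0-input the unambiguous certificates of the
  blocks fix the label. In both cases the positions read can be recovered from the values on
  them.\<close>

lemma unamb_cheat:
  assumes "unamb f (\<lambda>_. u)"
  shows "unamb cheat (\<lambda>b. c * (T + (T + (if b then 0 else u))))"
proof -
  obtain J U where "query_map f (\<lambda>_. u) J U" using assms unfolding unamb_def by blast
  note U = query_mapD[OF this]
  define Q where "Q y j = dec (content y j) \<union> (if cheat y then {} else U (block y j))" for y j
  define V where "V y = cell (label y) \<union> Inl ` Sigma {..<c} (Q y)" for y
  have Qf: "finite (Q y j)" for y j
    unfolding Q_def using finite_certs[OF dec_content] U(3) by simp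
  have "query_map cheat (\<lambda>b. c * (T + (T + (if b then 0 else u))))
      ((\<Union>l\<in>labels. cell l) \<union> Inl ` ({..<c} \<times> (J \<union> \<Union>\<A>))) V"
    unfolding query_map_def
  proof (intro conjI allI impI)
    show "finite ((\<Union>l\<in>labels. cell l) \<union> Inl ` ({..<c} \<times> (J \<union> \<Union>\<A>)))"
      using finite_labels finite_cell U(1) finite_A finite_certs by simp
  next
    fix y
    have "Q y j \<subseteq> J \<union> \<Union>\<A>" for j
      unfolding Q_def using dec_content[of y j] U(2)[of "block y j"] by auto
    then show "V y \<subseteq> (\<Union>l\<in>labels. cell l) \<union> Inl ` ({..<c} \<times> (J \<union> \<Union>\<A>))"
      unfolding V_def using label_in[of y] by (intro Un_mono UN_upper image_mono Sigma_mono) auto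
    have "card (Q y j) \<le> T + (if cheat y then 0 else u)" for j
    proof -
      have "card (Q y j) \<le> card (dec (content y j)) + card (if cheat y then {} else U (block y j))"
        unfolding Q_def by (rule card_Un_le)
      then show ?thesis
        using card_certs[OF dec_content, of y j] U(4)[of "block y j"] by (auto split: if_splits)
    qed
    then show "card (V y) \<le> c * (T + (T + (if cheat y then 0 else u)))"
      unfolding V_def using Qf by (intro card_sheet_set)
  next
    fix y z assume z: "\<forall>k\<in>V y. z k = y k"
    have Q: "\<forall>i\<in>Q y j. block z j i = block y j i" if "j < c" for j
      using agree_blocks[OF z[unfolded V_def] that] .
    have cl: "\<forall>k\<in>cell (label y). z k = y k" using z unfolding V_def by blast
    have d: "\<forall>i\<in>dec (content y j). block z j i = block y j i" if "j < c" for j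
      using Q[OF that] unfolding Q_def by blast
    have u: "f (block z j) = f (block y j) \<and> (cheat y \<or> U (block z j) = U (block y j))"
      if "j < c" for j
    proof (cases "cheat y")
      case True
      then have "certifies f (dec (content y j)) (block y j)" using that unfolding cheat_def by blast
      then have "f (block z j) = f (block y j)" using d[OF that] by (rule certifiesD)
      then show ?thesis using True by blast
    next
      case False
      then have "\<forall>i\<in>U (block y j). block z j i = block y j i"
        using Q[OF that] unfolding Q_def by simp
      from U(5)[OF this] show ?thesis by blast
    qed
    have ds: "\<forall>j<c. \<forall>i\<in>dec (content y j). block z j i = block y j i" using d by blast
    have "\<forall>j<c. f (block z j) = f (block y j)" using u by blast
    note st = cheat_stable[OF cl ds this]
    show "cheat z = cheat y" by (rule st(3))
    have "Q z j = Q y j" if "j < c" for j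
      unfolding Q_def st(2)[OF that] st(3) using u[OF that] by (cases "cheat y") simp_all
    then have "Sigma {..<c} (Q z) = Sigma {..<c} (Q y)" by (intro Sigma_cong) simp_all
    then show "V z = V y" unfolding V_def st(1) by simp
  qed
  then show ?thesis unfolding unamb_def by blast
qed

end

section \<open>The two measures on the cube\<close>

lemma query_map_restrict:
  assumes "query_map f u J U" and "J \<subseteq> I"
  shows "f (restrict x I) = f x"
proof -
  have "\<forall>i\<in>U x. restrict x I i = x i" using query_mapD(2)[OF assms(1), of x] assms(2) by auto
  then show ?thesis using query_mapD(5)[OF assms(1)] by blast
qed

lemma restrict_cube: "restrict x I \<in> cube I"
  unfolding cube_def by simp

lemma dt_restrict:
  assumes "dt_vars t \<subseteq> I"
  shows "dt_eval t (restrict x I) = dt_eval t x" and "dt_cost t (restrict x I) = dt_cost t x"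
  using assms by (induction t) auto

text \<open>A tree that is correct on the cube is correct on all total inputs, since neither the
  tree nor \<open>f\<close> looks outside \<open>I\<close>.\<close>

lemma D_ge_adversary:
  assumes "adversary f d Map.empty" and "query_map f u J U" and "J \<subseteq> I" and "finite I"
  shows "d \<le> D I f"
proof -
  have "\<exists>d t. dt_computes I t f \<and> (\<forall>x\<in>cube I. dt_cost t x \<le> d)"
    using dt_computes_exists[OF assms(4)] by blast
  from LeastI_ex[OF this] obtain t where t: "dt_computes I t f" "\<forall>x\<in>cube I. dt_cost t x \<le> D I f"
    unfolding D_def by blast
  have vars: "dt_vars t \<subseteq> I" using t(1) unfolding dt_computes_def by blast
  have "dt_eval t x = f x" for x
    using t(1) restrict_cube[of x I] dt_restrict(1)[OF vars] query_map_restrict[OF assms(2,3)]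
    unfolding dt_computes_def by metis
  then obtain x where "d \<le> dt_cost t x" using adversary_cost[OF assms(1)] by blast
  also have "dt_cost t x \<le> D I f"
    using t(2) restrict_cube[of x I] dt_restrict(2)[OF vars] by metis
  finally show ?thesis .
qed

text \<open>Fixing the bits on \<open>U x\<close> yields the family. Two members consistent with a
  common input coincide, because \<open>U\<close> is constant on the subcube of each member.\<close>

lemma UCb_le_query_map:
  assumes "query_map f u J U" and "J \<subseteq> I"
  shows "UCb b I f \<le> u b"
proof -
  note U = query_mapD[OF assms(1)]
  define p where "p x i = (if i \<in> U x then Some (x i) else None)" for x i
  have dom: "dom (p x) = U x" for x unfolding p_def by (auto simp: dom_def)
  have cons: "consistent (p x) y \<longleftrightarrow> (\<forall>i\<in>U x. y i = x i)" for x y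
    unfolding consistent_def dom by (auto simp: p_def)
  have uniq: "p x = p y" if "consistent (p x) y" for x y
  proof -
    have *: "\<forall>i\<in>U x. y i = x i" using that unfolding cons .
    then have "U y = U x" using U(5)[OF *] by blast
    then show ?thesis unfolding p_def using * by (intro ext) auto
  qed
  have "unambiguous_family I f b (p ` {x \<in> cube I. f x = b})"
    unfolding unambiguous_family_def
  proof (intro conjI ballI impI)
    fix q assume "q \<in> p ` {x \<in> cube I. f x = b}"
    then obtain x where x: "x \<in> cube I" "f x = b" "q = p x" by auto
    have "certificate I f x q"
      unfolding certificate_def x(3) dom
    proof (intro conjI ballI impI)
      show "U x \<subseteq> I" using U(2) assms(2) by blast
      show "consistent (p x) x" by (simp add: cons)
      show "f y = f x" if "consistent (p x) y" for y
        using U(5)[OF that[unfolded cons]] by (rule conjunct1)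
    qed
    then show "\<exists>x\<in>cube I. f x = b \<and> certificate I f x q" using x by blast
  next
    fix x assume x: "x \<in> cube I" "f x = b"
    show "\<exists>!q. q \<in> p ` {x \<in> cube I. f x = b} \<and> consistent q x"
    proof (rule ex1I[of _ "p x"])
      show "p x \<in> p ` {x \<in> cube I. f x = b} \<and> consistent (p x) x"
        using x cons by blast
      show "q = p x" if "q \<in> p ` {x \<in> cube I. f x = b} \<and> consistent q x" for q
        using that uniq by blast
    qed
  qed
  moreover have "\<forall>q\<in>p ` {x \<in> cube I. f x = b}. card (dom q) \<le> u b"
  proof
    fix q assume "q \<in> p ` {x \<in> cube I. f x = b}"
    then obtain x where "f x = b" "q = p x" by auto
    then show "card (dom q) \<le> u b" using U(4)[of x] dom by simp
  qed
  ultimately show ?thesis unfolding UCb_def by (intro Least_le) blast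
qed

text \<open>The input \<open>x\<close> makes every unambiguous 1-family nonempty, and the domain of
  a member is a set of positions to which \<open>min_cert\<close> applies.\<close>

lemma UCb_ge_min_cert:
  assumes "min_cert f s" and "f x" and "query_map f u J U" and "J \<subseteq> I" and "finite I"
  shows "s \<le> UCb True I f"
proof -
  note restr = query_map_restrict[OF assms(3,4)]
  obtain P where "unambiguous_family I f True P \<and> (\<forall>p\<in>P. dom p = I)"
    using unambiguous_family_exists[of I f True] by (elim exE)
  then have "\<exists>w P. unambiguous_family I f True P \<and> (\<forall>p\<in>P. card (dom p) \<le> w)"
    by (intro exI[of _ "card I"] exI[of _ P]) simp
  from LeastI_ex[OF this] obtain P where P: "unambiguous_family I f True P"
    "\<forall>p\<in>P. card (dom p) \<le> UCb True I f"
    unfolding UCb_def by blast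
  have "f (restrict x I) = True" using restr assms(2) by simp
  then obtain p where "p \<in> P"
    using P(1) restrict_cube[of x I] unfolding unambiguous_family_def by blast
  then obtain y where y: "f y" "certificate I f y p"
    using P(1) unfolding unambiguous_family_def by blast
  have "certifies f (dom p) y"
    unfolding certifies_def
  proof (intro allI impI)
    fix z assume "\<forall>i\<in>dom p. z i = y i"
    then have "consistent p (restrict z I)"
      using y(2) unfolding certificate_def consistent_def by auto
    then have "f (restrict z I) = f y"
      using y(2) restrict_cube unfolding certificate_def by blast
    then show "f z = f y" using restr by simp
  qed
  moreover have "finite (dom p)" using y(2) assms(5) finite_subset unfolding certificate_def by blast
  ultimately have "s \<le> card (dom p)" using assms(1) y(1) unfolding min_cert_def by blast
  also have "\<dots> \<le> UCb True I f" using P(2) \<open>p \<in> P\<close> by blast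
  finally show ?thesis .
qed

section \<open>Iteration\<close>

text \<open>Coding the variables by \<open>to_nat\<close> returns to type \<open>nat\<close>, so
  that rounds can be iterated at one type.\<close>

lemma conj_step:
  fixes f :: "('a::countable \<Rightarrow> bool) \<Rightarrow> bool"
  assumes "adversary f d Map.empty" and "d > 0" and "n \<le> 2 ^ m"
    and "certifiable f False w0" and "certifiable f True w1" and "unamb f u"
  shows "\<exists>g :: (nat \<Rightarrow> bool) \<Rightarrow> bool. adversary g (n * d) Map.empty \<and>
    certifiable g False (w0 + m) \<and> certifiable g True (n * w1) \<and>
    unamb g (\<lambda>b. n * u True + (if b then 0 else u False)) \<and> min_cert g n"
proof -
  obtain x where "\<not> f x" using adversary_undecided[OF assms(1,2), of False] by blast
  have inj: "inj (to_nat :: nat \<times> 'a \<Rightarrow> nat)" by simp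
  have "adversary (conj_comp n f) (n * d) (Map.empty \<circ> to_nat)"
    using adversary_conj_comp[OF assms(1,2)] by (simp add: comp_def)
  moreover have "min_cert (conj_comp n f) n" using \<open>\<not> f x\<close> by (rule min_cert_conj_comp)
  ultimately show ?thesis
    using adversary_reindex[OF inj] min_cert_reindex[OF inj]
      certifiable_reindex[OF certifiable_conj_comp_False[OF assms(4,3)]]
      certifiable_reindex[OF certifiable_conj_comp_True[OF assms(5)]]
      unamb_reindex[OF unamb_conj_comp[OF assms(6)]]
    by (intro exI[of _ "\<lambda>y. conj_comp n f (y \<circ> to_nat)"] conjI)
qed

text \<open>By De Morgan this is \<open>conj_step\<close> for the negation of \<open>f\<close>,
  negated again, with the two values exchanging roles.\<close>

lemma disj_step:
  fixes f :: "('a::countable \<Rightarrow> bool) \<Rightarrow> bool"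
  assumes "adversary f d Map.empty" and "d > 0" and "n \<le> 2 ^ m"
    and "certifiable f False w0" and "certifiable f True w1" and "unamb f u"
  shows "\<exists>g :: (nat \<Rightarrow> bool) \<Rightarrow> bool. adversary g (n * d) Map.empty \<and>
    certifiable g False (n * w0) \<and> certifiable g True (w1 + m) \<and>
    unamb g (\<lambda>b. n * u False + (if b then u True else 0))"
proof -
  have "certifiable (\<lambda>x. \<not> f x) False w1" "certifiable (\<lambda>x. \<not> f x) True w0"
    using assms(4,5) by (simp_all add: certifiable_not)
  then obtain g :: "(nat \<Rightarrow> bool) \<Rightarrow> bool" where g: "adversary g (n * d) Map.empty"
    "certifiable g False (w1 + m)" "certifiable g True (n * w0)"
    "unamb g (\<lambda>b. n * u (\<not> True) + (if b then 0 else u (\<not> False)))"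
    using conj_step[OF _ assms(2,3) _ _ unamb_not[OF assms(6)]] assms(1)
    unfolding adversary_not by blast
  have "unamb (\<lambda>x. \<not> g x) (\<lambda>b. n * u False + (if b then u True else 0))"
    using unamb_not[OF g(4)] by (rule unamb_mono) simp
  then show ?thesis
    using g(1-3) by (intro exI[of _ "\<lambda>x. \<not> g x"]) (simp add: adversary_not certifiable_not)
qed

text \<open>A left inverse of an injective naming; words that name nothing are sent to the default
  \<open>a\<close>.\<close>

lemma ex_decoder:
  assumes "finite \<A>" and "a \<in> \<A>" and "card \<A> \<le> 2 ^ T"
  shows "\<exists>dec. dec ` Pow {..<T::nat} = \<A>"
proof -
  have "card \<A> \<le> card (Pow {..<T})" using assms(3) by (simp add: card_Pow)
  then obtain h where h: "h ` \<A> \<subseteq> Pow {..<T}" "inj_on h \<A>"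
    using card_le_inj[OF assms(1), of "Pow {..<T}"] by auto
  let ?dec = "\<lambda>z. if z \<in> h ` \<A> then inv_into \<A> h z else a"
  have "?dec ` Pow {..<T} = \<A>"
  proof
    show "?dec ` Pow {..<T} \<subseteq> \<A>" using assms(2) by (auto intro: inv_into_into)
    show "\<A> \<subseteq> ?dec ` Pow {..<T}"
    proof
      fix A assume "A \<in> \<A>"
      then have "A = ?dec (h A)" using h(2) by simp
      then show "A \<in> ?dec ` Pow {..<T}" using h(1) \<open>A \<in> \<A>\<close> by blast
    qed
  qed
  then show ?thesis by blast
qed

text \<open>The sets for both values and the empty set number at most \<open>2 * 2 ^ w + 1\<close>,
  which fits into \<open>w + 2\<close> bits. With \<open>c\<close> blocks there are at least
  \<open>d\<close> cells, as the adversary requires.\<close>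

lemma cheat_step:
  fixes f :: "(nat \<Rightarrow> bool) \<Rightarrow> bool"
  assumes "adversary f d Map.empty" and "d \<le> 2 ^ c" and "c > 0"
    and "\<And>b. certifiable f b w" and "unamb f (\<lambda>_. u)"
  shows "\<exists>g :: (nat sheet \<Rightarrow> bool) \<Rightarrow> bool. adversary g d Map.empty \<and>
    (\<forall>b. certifiable g b (c * (3 * (w + 2) + 1))) \<and>
    unamb g (\<lambda>b. c * (w + 2 + (w + 2 + (if b then 0 else u))))"
proof -
  obtain \<S> where "\<And>b. cert_sets f b w (\<S> b)" using assms(4) unfolding certifiable_def by metis
  note S = cert_setsD[OF this]
  let ?A = "insert {} (\<S> False \<union> \<S> True)"
  have fin: "finite ?A" using S(1) by simp
  have "card ?A \<le> Suc (card (\<S> False \<union> \<S> True))" by (rule card_insert_le_m1) simp_all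
  also have "card (\<S> False \<union> \<S> True) \<le> 2 ^ w + 2 ^ w"
    using card_Un_le[of "\<S> False" "\<S> True"] S(2)[of False] S(2)[of True] by linarith
  also have "Suc (2 ^ w + 2 ^ w) \<le> 2 ^ (w + 2)" by simp
  finally have card: "card ?A \<le> 2 ^ (w + 2)" by simp
  obtain dec where dec: "dec ` Pow {..<w + 2} = ?A" using ex_decoder[OF fin insertI1 card] ..
  interpret cheat_sheet f c "w + 2" ?A dec
  proof
    show "card ?A \<le> 2 ^ (w + 2)" by (rule card)
    show "finite A" if "A \<in> ?A" for A using that S(3) by auto
    show "card A \<le> w + 2" if "A \<in> ?A" for A
    proof -
      have "card A \<le> w" using that S(4) by auto
      then show ?thesis by (rule trans_le_add1)
    qed
    show "\<exists>A\<in>?A. certifies f A x" for x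
      using S(5)[of x "f x"] by (cases "f x") auto
  qed (use dec assms(3) in auto)
  have "adversary cheat d Map.empty"
    using assms(1,2) by (intro adversary_cheat) (simp_all add: touched_def)
  then show ?thesis using certifiable_cheat unamb_cheat[OF assms(5)] by blast
qed

text \<open>\<open>A\<close> collects the factors lost so far. The 0-certificates are shorter than
  the 1-certificates by a factor \<open>2 ^ m\<close>; in the next round OR lengthens the former to
  the same order, and AND restores the gap.\<close>

definition stage :: "nat \<Rightarrow> nat \<Rightarrow> nat \<Rightarrow> ((nat \<Rightarrow> bool) \<Rightarrow> bool) \<Rightarrow> bool" where
  "stage m k A f \<longleftrightarrow> adversary f ((2 ^ m) ^ (2 * k + 1)) Map.empty \<and>
     certifiable f False (A * (2 ^ m) ^ k) \<and> certifiable f True (A * (2 ^ m) ^ (k + 1)) \<and>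
     unamb f (\<lambda>_. A * (2 ^ m) ^ (k + 1)) \<and> min_cert f (2 ^ m)"

lemma stage_base:
  assumes "m > 0"
  shows "\<exists>f. stage m 0 (m + 1) f"
proof -
  let ?v = "\<lambda>x :: nat \<Rightarrow> bool. x 0"
  have "\<exists>x. ?v x = b" for b by (rule exI[of _ "\<lambda>_. b"]) simp
  then have "adversary ?v 1 Map.empty" by (simp add: consistent_def)
  moreover have "cert_sets ?v b 1 {{0}}" for b unfolding cert_sets_def certifies_def by simp
  then have "certifiable ?v b 1" for b unfolding certifiable_def by blast
  moreover have "query_map ?v (\<lambda>_. 1) {0} (\<lambda>_. {0})" unfolding query_map_def by simp
  then have "unamb ?v (\<lambda>_. 1)" unfolding unamb_def by blast
  ultimately obtain g :: "(nat \<Rightarrow> bool) \<Rightarrow> bool" where g: "adversary g (2 ^ m * 1) Map.empty"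
    "certifiable g False (1 + m)" "certifiable g True (2 ^ m * 1)"
    "unamb g (\<lambda>b. 2 ^ m * 1 + (if b then 0 else 1))" "min_cert g (2 ^ m)"
    using conj_step[of ?v 1 "2 ^ m" m 1 1 "\<lambda>_. 1"] by auto
  \<comment> \<open>The unambiguous bound \<open>2 ^ m + 1\<close> is at most
    \<open>2 * 2 ^ m\<close>, hence covered by the factor \<open>m + 1\<close>.\<close>
  have "2 * 2 ^ m \<le> (m + 1) * 2 ^ m" using assms by (intro mult_le_mono1) simp
  moreover have "(1::nat) \<le> 2 ^ m" by simp
  ultimately have "2 ^ m * 1 + (if b then 0 else 1) \<le> (m + 1) * 2 ^ m" for b
    by (cases b) simp_all
  then have "unamb g (\<lambda>_. (m + 1) * 2 ^ m)" by (rule unamb_mono[OF g(4)])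
  moreover have "certifiable g True ((m + 1) * 2 ^ m)" using g(3) by (rule certifiable_mono) simp
  ultimately have "stage m 0 (m + 1) g" unfolding stage_def using g by simp
  then show ?thesis by blast
qed

text \<open>The round is OR, then cheat sheet, then AND. After OR all certificates have length at
  most \<open>2 * (A * X)\<close>, while the unambiguous ones are larger by a factor
  \<open>n\<close>. The cheat sheet removes this factor for value 1, so the final AND brings it in
  only once.\<close>

lemma stage_step:
  assumes f: "stage m k A f" and m: "m > 0" and A: "m \<le> A" "2 \<le> A"
  shows "\<exists>g. stage m (Suc k) (28 * (k + 1) * m * A) g"
proof -
  define n :: nat where "n = 2 ^ m"
  define X where "X = n ^ (k + 1)"
  \<comment> \<open>\<open>2 ^ c\<close> equals \<open>n ^ (2 * k + 2)\<close>, the adversary budget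
    after OR, so the cells are just numerous enough.\<close>
  define c where "c = 2 * (k + 1) * m"
  have n: "n \<ge> 1" "n \<le> 2 ^ m" unfolding n_def by simp_all
  have X: "X \<ge> 1" "n * n ^ k = X" unfolding X_def using n by simp_all
  have AX: "m \<le> A * X" "2 \<le> A * X"
    using A X(1) mult_le_mono[OF A(1) X(1)] mult_le_mono[OF A(2) X(1)] by simp_all
  have c: "c > 0" unfolding c_def using m by simp
  have nc: "n * n ^ (2 * k + 1) = 2 ^ c"
    unfolding n_def c_def by (simp flip: power_mult power_add add: algebra_simps)
  have f': "adversary f (n ^ (2 * k + 1)) Map.empty" "certifiable f False (A * n ^ k)"
    "certifiable f True (A * X)" "unamb f (\<lambda>_. A * X)"
    using f unfolding stage_def n_def X_def by blast+
  obtain g :: "(nat \<Rightarrow> bool) \<Rightarrow> bool" where g: "adversary g (n * n ^ (2 * k + 1)) Map.empty"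
    "certifiable g False (n * (A * n ^ k))" "certifiable g True (A * X + m)"
    "unamb g (\<lambda>b. n * (A * X) + (if b then A * X else 0))"
    using disj_step[OF f'(1) _ n(2) f'(2-4)] n(1) by auto
  have "certifiable g b (2 * (A * X))" for b
  proof (cases b)
    case True
    then show ?thesis using certifiable_mono[OF g(3)] AX(1) by simp
  next
    case False
    have "n * (A * n ^ k) = A * X" unfolding X(2)[symmetric] by (rule mult.left_commute)
    then have "n * (A * n ^ k) \<le> 2 * (A * X)" by linarith
    from certifiable_mono[OF g(2) this] show ?thesis using False by simp
  qed
  moreover have "n * (A * X) + (if b then A * X else 0) \<le> 2 * (n * (A * X))" for b
    using n(1) by simp
  then have "unamb g (\<lambda>_. 2 * (n * (A * X)))" by (rule unamb_mono[OF g(4)])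
  ultimately obtain h :: "(nat sheet \<Rightarrow> bool) \<Rightarrow> bool" where
    h: "adversary h (n * n ^ (2 * k + 1)) Map.empty"
    "\<And>b. certifiable h b (c * (3 * (2 * (A * X) + 2) + 1))"
    "unamb h (\<lambda>b. c * (2 * (A * X) + 2 + (2 * (A * X) + 2 + (if b then 0 else 2 * (n * (A * X))))))"
    using cheat_step[OF g(1) _ c, of "2 * (A * X)" "2 * (n * (A * X))"] nc by auto
  have ch: "certifiable h b (10 * (c * (A * X)))" for b
  proof (rule certifiable_mono[OF h(2)])
    have "c * (3 * (2 * (A * X) + 2) + 1) \<le> c * (10 * (A * X))"
      using AX(2) by (intro mult_le_mono2) (simp add: distrib_left)
    then show "c * (3 * (2 * (A * X) + 2) + 1) \<le> 10 * (c * (A * X))" by (simp only: mult.left_commute)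
  qed
  have AnX: "A * X \<le> n * (A * X)" using n(1) by simp
  have uh: "unamb h (\<lambda>b. if b then 6 * (c * (A * X)) else 8 * (n * (c * (A * X))))"
  proof (rule unamb_mono[OF h(3)])
    fix b
    have "2 * Y + 2 + (2 * Y + 2 + (if b then 0 else 2 * Z)) \<le> (if b then 6 * Y else 8 * Z)"
      if "2 \<le> Y" "Y \<le> Z" for Y Z :: nat
      using that by (cases b) simp_all
    from mult_le_mono2[OF this[OF AX(2) AnX], of c]
    have "c * (2 * (A * X) + 2 + (2 * (A * X) + 2 + (if b then 0 else 2 * (n * (A * X)))))
        \<le> c * (if b then 6 * (A * X) else 8 * (n * (A * X)))" .
    then show "c * (2 * (A * X) + 2 + (2 * (A * X) + 2 + (if b then 0 else 2 * (n * (A * X)))))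
        \<le> (if b then 6 * (c * (A * X)) else 8 * (n * (c * (A * X))))"
      by (cases b) (simp_all add: mult.left_commute)
  qed
  obtain e :: "(nat \<Rightarrow> bool) \<Rightarrow> bool" where e: "adversary e (n * (n * n ^ (2 * k + 1))) Map.empty"
    "certifiable e False (10 * (c * (A * X)) + m)" "certifiable e True (n * (10 * (c * (A * X))))"
    "unamb e (\<lambda>b. n * (if True then 6 * (c * (A * X)) else 8 * (n * (c * (A * X)))) +
      (if b then 0 else if False then 6 * (c * (A * X)) else 8 * (n * (c * (A * X)))))"
    "min_cert e n"
    using conj_step[OF h(1) _ n(2) ch ch uh] n(1) by auto
  \<comment> \<open>The 14 is 6 + 8: on a 0-input, AND reads up to \<open>n\<close> unambiguous
    1-certificates of length \<open>6 * (c * (A * X))\<close> and one 0-certificate of length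
    \<open>8 * (n * (c * (A * X)))\<close>. The other bounds need at most 11, and the factor 2 in
    \<open>c\<close> turns 14 into 28.\<close>
  have A': "28 * (k + 1) * m * A * X = 14 * (c * (A * X))" unfolding c_def by (simp add: algebra_simps)
  have "stage m (Suc k) (28 * (k + 1) * m * A) e"
    unfolding stage_def n_def[symmetric]
  proof (intro conjI)
    show "adversary e (n ^ (2 * Suc k + 1)) Map.empty" using e(1) by simp
    have "m \<le> c * (A * X)" using AX(1) c by (metis Suc_leI mult_le_mono nat_mult_1 One_nat_def)
    then have "10 * (c * (A * X)) + m \<le> 28 * (k + 1) * m * A * X" unfolding A' by linarith
    then show "certifiable e False (28 * (k + 1) * m * A * n ^ Suc k)"
      using certifiable_mono[OF e(2)] unfolding X_def by simp
    have eq: "28 * (k + 1) * m * A * n ^ (Suc k + 1) = n * (14 * (c * (A * X)))"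
      unfolding A'[symmetric] unfolding X_def by simp
    show "certifiable e True (28 * (k + 1) * m * A * n ^ (Suc k + 1))"
      unfolding eq by (rule certifiable_mono[OF e(3)]) simp
    show "unamb e (\<lambda>_. 28 * (k + 1) * m * A * n ^ (Suc k + 1))"
      unfolding eq by (rule unamb_mono[OF e(4)]) simp
    show "min_cert e n" by (rule e(5))
  qed
  then show ?thesis by blast
qed

section \<open>Accumulated loss and choice of parameters\<close>

primrec loss :: "nat \<Rightarrow> nat \<Rightarrow> nat" where
  "loss m 0 = m + 1"
| "loss m (Suc k) = 28 * (k + 1) * m * loss m k"

text \<open>Supplies the two lower bounds on \<open>A\<close> that \<open>stage_step\<close> asks
  for.\<close>

lemma loss_ge: "m > 0 \<Longrightarrow> m + 1 \<le> loss m k"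
proof (induction k)
  case (Suc k)
  then have "1 * loss m k \<le> 28 * (k + 1) * m * loss m k" by (intro mult_le_mono1) simp
  then have "loss m k \<le> loss m (Suc k)" by simp
  with Suc show ?case by linarith
qed simp

lemma ex_stage:
  assumes "m > 0"
  shows "\<exists>f. stage m k (loss m k) f"
proof (induction k)
  case 0
  show ?case using stage_base[OF assms] by simp
next
  case (Suc k)
  then obtain f where "stage m k (loss m k) f" ..
  from stage_step[OF this assms] show ?case using loss_ge[OF assms, of k] assms by simp
qed

lemma loss_polynomial: "\<exists>C. \<forall>m. loss m k \<le> C * (m + 1) ^ (k + 1)"
proof (induction k)
  case 0
  show ?case by (rule exI[of _ 1]) simp
next
  case (Suc k)
  then obtain C where C: "\<And>m. loss m k \<le> C * (m + 1) ^ (k + 1)" by blast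
  have "loss m (Suc k) \<le> 28 * (k + 1) * C * (m + 1) ^ (Suc k + 1)" for m
  proof -
    have "m * loss m k \<le> (m + 1) * (C * (m + 1) ^ (k + 1))" using C by (intro mult_le_mono) auto
    then have "28 * (k + 1) * (m * loss m k) \<le> 28 * (k + 1) * ((m + 1) * (C * (m + 1) ^ (k + 1)))"
      by (rule mult_le_mono2)
    then show ?thesis by (simp add: algebra_simps)
  qed
  then show ?case by blast
qed

text \<open>For fixed \<open>k\<close> the loss is polynomial in \<open>m\<close>, so its square
  falls below \<open>2 ^ m\<close>. The square appears because UC is later raised to a power at most
  2.\<close>

lemma ex_small_loss: "\<exists>m. m > 0 \<and> k \<le> m \<and> (loss m k)\<^sup>2 \<le> 2 ^ m"
proof -
  obtain C where C: "\<And>m. loss m k \<le> C * (m + 1) ^ (k + 1)" using loss_polynomial by blast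
  define p where "p = k + 1"
  define q where "q = 2 * real p"
  have "((\<lambda>m. (real m + 1) powr q / 2 ^ m) \<longlongrightarrow> 0) sequentially" by real_asymp
  from tendsto_mult_right_zero[OF this, of "(real C)\<^sup>2"]
  have "((\<lambda>m. (real C * (real m + 1) ^ p)\<^sup>2 / 2 ^ m) \<longlongrightarrow> 0) sequentially"
  proof (rule Lim_transform_eventually)
    have "(real m + 1) powr q = ((real m + 1) ^ p)\<^sup>2" for m
      using powr_realpow[of "real m + 1" "p * 2"] unfolding q_def
      by (simp add: power_mult mult.commute)
    then show "\<forall>\<^sub>F m in sequentially. (real C)\<^sup>2 * ((real m + 1) powr q / 2 ^ m)
        = (real C * (real m + 1) ^ p)\<^sup>2 / 2 ^ m"
      by (simp add: power_mult_distrib)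
  qed
  then have "\<forall>\<^sub>F m in sequentially. (real C * (real m + 1) ^ p)\<^sup>2 / 2 ^ m < 1"
    by (rule order_tendstoD) simp
  moreover have "\<forall>\<^sub>F m in sequentially. m > 0 \<and> k \<le> m"
    using eventually_ge_at_top[of "k + 1"] by eventually_elim simp
  ultimately have "\<forall>\<^sub>F m in sequentially. (real C * (real m + 1) ^ p)\<^sup>2 / 2 ^ m < 1 \<and> m > 0 \<and> k \<le> m"
    by eventually_elim simp
  then obtain m where m: "(real C * (real m + 1) ^ p)\<^sup>2 / 2 ^ m < 1" "m > 0" "k \<le> m"
    unfolding eventually_sequentially by blast
  have "real (loss m k) \<le> real (C * (m + 1) ^ p)" using C[of m] unfolding p_def by (rule of_nat_mono)
  then have "(real (loss m k))\<^sup>2 \<le> (real C * (real m + 1) ^ p)\<^sup>2"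
    by (intro power_mono) (simp_all add: add.commute)
  also have "\<dots> \<le> 2 ^ m" using m(1) by (simp add: divide_simps)
  finally have "real ((loss m k)\<^sup>2) \<le> real (2 ^ m)" by simp
  then show ?thesis using m(2,3) by (metis of_nat_le_iff)
qed

text \<open>The exponent times \<open>k + 1\<close> is \<open>2 * k\<close>, so UC to this power is
  at most \<open>A\<^sup>2 * n ^ (2 * k)\<close>. The adversary gives
  \<open>n ^ (2 * k + 1)\<close>, and its spare factor \<open>n\<close> absorbs
  \<open>A\<^sup>2\<close>.\<close>

lemma ex_separation:
  "\<exists>N (f :: (nat \<Rightarrow> bool) \<Rightarrow> bool). k \<le> UC {..<N} f \<and>
     real (UC {..<N} f) powr (2 - 2 / (real k + 1)) \<le> real (D {..<N} f)"
proof -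
  obtain m where m: "m > 0" "k \<le> m" "(loss m k)\<^sup>2 \<le> 2 ^ m" using ex_small_loss by blast
  obtain f where f: "stage m k (loss m k) f" using ex_stage[OF m(1)] by blast
  define n :: nat where "n = 2 ^ m"
  define A where "A = loss m k"
  define u where "u = A * n ^ (k + 1)"
  have n: "n \<ge> 1" unfolding n_def by simp
  have adv: "adversary f (n ^ (2 * k + 1)) Map.empty" and mc: "min_cert f n" and "unamb f (\<lambda>_. u)"
    using f unfolding stage_def n_def A_def u_def by blast+
  then obtain J U where q: "query_map f (\<lambda>_. u) J U" unfolding unamb_def by blast
  \<comment> \<open>A cube containing the finite set \<open>J\<close> of relevant variables serves
    for both measures.\<close>
  obtain N where N: "J \<subseteq> {..<N}" using query_mapD(1)[OF q] unfolding finite_nat_set_iff_bounded by blast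
  have fin: "finite {..<N}" by simp
  obtain x where "f x" using adversary_undecided[OF adv, of True] n by auto
  then have "n \<le> UC {..<N} f"
    using UCb_ge_min_cert[OF mc _ q N fin] unfolding UC_def by (simp add: le_max_iff_disj)
  moreover have "k \<le> n" using m(2) less_exp[of m] unfolding n_def by linarith
  ultimately have "k \<le> UC {..<N} f" by simp
  moreover have "real (UC {..<N} f) powr (2 - 2 / (real k + 1)) \<le> real (D {..<N} f)"
  proof -
    let ?e = "2 - 2 / (real k + 1)"
    have e: "0 \<le> ?e" "?e \<le> 2" "?e * (real k + 1) = 2 * real k" by (simp_all add: field_simps)
    have A1: "A \<ge> 1" unfolding A_def using loss_ge[OF m(1), of k] by simp
    have "UC {..<N} f \<le> u" using UCb_le_query_map[OF q N] unfolding UC_def by simp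
    then have "real (UC {..<N} f) powr ?e \<le> real u powr ?e" using e(1) by (intro powr_mono2) simp_all
    also have "real u = real A * real n powr (real k + 1)"
      unfolding u_def using n by (simp add: powr_add powr_realpow)
    also have "\<dots> powr ?e = real A powr ?e * real n powr (2 * real k)"
      using e(3) by (simp add: powr_mult powr_powr mult.commute)
    also have "\<dots> \<le> real A powr 2 * real n powr (2 * real k)"
      using A1 e(2) by (intro mult_right_mono powr_mono) simp_all
    also have "\<dots> = real (A\<^sup>2 * n ^ (2 * k))"
      using A1 n powr_realpow[of "real n" "2 * k"] by (simp add: powr_numeral)
    also have "\<dots> \<le> real (n ^ (2 * k + 1))"
      using mult_le_mono1[of "A\<^sup>2" n "n ^ (2 * k)"] m(3) unfolding A_def n_def
      by (intro of_nat_mono) simp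
    also have "\<dots> \<le> real (D {..<N} f)" using D_ge_adversary[OF adv q N fin] by (rule of_nat_mono)
    finally show ?thesis .
  qed
  ultimately show ?thesis by blast
qed

theorem theorem2:
  shows "\<exists>(N :: nat \<Rightarrow> nat) (f :: nat \<Rightarrow> (nat \<Rightarrow> bool) \<Rightarrow> bool) (\<epsilon> :: nat \<Rightarrow> real).
    filterlim (\<lambda>j. UC {..<N j} (f j)) at_top sequentially \<and>
    \<epsilon> \<longlonglongrightarrow> 0 \<and>
    (\<forall>j. real (D {..<N j} (f j)) \<ge> real (UC {..<N j} (f j)) powr (2 - \<epsilon> j))"
proof -
  obtain N and f :: "nat \<Rightarrow> (nat \<Rightarrow> bool) \<Rightarrow> bool" where
    Nf: "\<And>k. k \<le> UC {..<N k} (f k)"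
    "\<And>k. real (UC {..<N k} (f k)) powr (2 - 2 / (real k + 1)) \<le> real (D {..<N k} (f k))"
    using ex_separation by metis
  have "filterlim (\<lambda>j. UC {..<N j} (f j)) at_top sequentially"
    by (rule filterlim_at_top_mono[OF filterlim_ident]) (simp add: Nf(1))
  \<comment> \<open>The \<open>k\<close>-th function uses \<open>k\<close> rounds, and
    \<open>2 / (k + 1)\<close> is its deficit from the exponent 2.\<close>
  moreover have "(\<lambda>k. 2 / (real k + 1)) \<longlonglongrightarrow> 0" by real_asymp
  ultimately show ?thesis using Nf(2) by blast
qed

end
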